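(* Let $F,\hat F\in W^{-s,G_{:}^*}(\Omega)$ and let $u,\hat u\in W^{s,G_{:}}_0(\Omega)$ be the solutions of the Dirichlet problems $$\langle \mathcal{L}_g^su,v\rangle=\langle F,v\rangle,\qquad \langle \mathcal{L}_g^s\hat u,v\rangle=\langle \hat F,v\rangle\qquad\forall v\in W^{s,G_{:}}_0(\Omega).$$ Then $$F\ge\hat F\ \text{ in }W^{-s,G_{:}^*}(\Omega)\quad\text{implies}\quad u\ge\hat u\ \text{ a.e. in }\Omega.$$
   Context: Setting. Let $0<s<1$ and let $\Omega\subset\mathbb{R}^d$ be a bounded domain with Lipschitz boundary. Let $g=g(x,y,r):\mathbb{R}^d\times\mathbb{R}^d\times\mathbb{R}^+\to\mathbb{R}^+$ be a positive measurable function, Lipschitz continuous in $r$, such that for a.e. $x,y$: $\lim_{r\to0^+}rg(x,y,r)=0$, $\lim_{r\to+\infty}rg(x,y,r)=+\infty$, and, with $g'=\partial_r g$, $$0<g_*\le \frac{r g'(x,y,r)}{g(x,y,r)}+1\le g^*\quad\text{for } r>0,$$ for constants $0<g_*\le g^*$. Put $\bar g(x,y,r)=rg(x,y,r)$, $G_{:}=G(x,y,r)=\int_0^r\bar g(x,y,\rho)\,d\rho$ and $\hat G_\cdot(r)=G(x,x,r)$. Set $\delta^s u(x,y)=\frac{u(x)-u(y)}{|x-y|^s}$. Spaces. $\Gamma_{\hat G_\cdot}(u)=\int_{\mathbb{R}^d}G(x,x,|u(x)|)\,dx$, $\Gamma_{s,G_{:}}(u)=\int_{\mathbb{R}^d}\int_{\mathbb{R}^d}G(x,y,|\delta^s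 u(x,y)|)\frac{dx\,dy}{|x-y|^d}$. $L^{\hat G_\cdot}(\mathbb{R}^d)$ is the set of measurable $u$ with $\Gamma_{\hat G_\cdot}(u)<\infty$; $W^{s,G_{:}}(\mathbb{R}^d)=\{u\in L^{\hat G_\cdot}(\mathbb{R}^d):\Gamma_{s,G_{:}}(u)<\infty\}$, with the norm $\|u\|_{s,G}=\|u\|_G+[u]_{s,G}$, where $\|u\|_G=\inf\{\lambda>0:\Gamma_{\hat G_\cdot}(u/\lambda)\le1\}$ and $[u]_{s,G}=\inf\{\lambda>0:\Gamma_{s,G_{:}}(u/\lambda)\le1\}$. $W^{s,G_{:}}_0(\Omega)$ is the closure of $C_c^\infty(\Omega)$ in $\|\cdot\|_{s,G}$; its elements are extended by $0$ to $\mathbb{R}^d\setminus\Omega$. Its dual is $W^{-s,G_{:}^*}(\Omega)$, with duality pairing $\langle\cdot,\cdot\rangle$. Operator. $\mathcal{L}_g^s:W^{s,G_{:}}_0(\Omega)\to W^{-s,G_{:}^*}(\Omega)$ is $\langle\mathcal{L}_g^su,v\rangle=\int_{\mathbb{R}^d}\int_{\mathbb{R}^d}g(x,y,|\delta^s u(x,y)|)\,\delta^s u(x,y)\,\delta^s v(x,y)\frac{dx\,dy}{|x-y|^d}$. The Dirichlet problem has a unique solution for each $F\in W^{-s,G_{:}^*}(\Omega)$. Order in the dual: $F\ge0$ in $W^{-s,G_{:}^*}(\Omega)$ if and only if $\langle F,v\rangle\ge0$ for all $v\in W^{s,G_{:}}_0(\Omega)$ with $v\ge0$; $F\ge\hat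 F$ means $F-\hat F\ge0$. *)

theory Defs
  imports "HOL-Analysis.Analysis"
begin

text \<open>The Euclidean space of dimension \<open>d\<close> is a type \<open>'a :: euclidean_space\<close> with \<open>d = DIM('a)\<close>.
  Elements of the function spaces are functions on the whole space; they are not quotiented by
  almost everywhere equality.\<close>

text \<open>Near each boundary point, up to a rigid motion, \<open>\<Omega>\<close> is the region above the graph of a
  Lipschitz function on the hyperplane orthogonal to \<open>\<nu>\<close>.\<close>

definition lipschitz_boundary :: "'a::euclidean_space set \<Rightarrow> bool" where
  "lipschitz_boundary \<Omega> \<longleftrightarrow>
    (\<forall>p \<in> frontier \<Omega>. \<exists>\<nu> r L \<phi>. norm \<nu> = 1 \<and> r > 0 \<and>
       L-lipschitz_on {y. y \<bullet> \<nu> = 0} (\<phi> :: 'a \<Rightarrow> real) \<and>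
       \<Omega> \<inter> ball p r = {x \<in> ball p r. x \<bullet> \<nu> > \<phi> (x - (x \<bullet> \<nu>) *\<^sub>R \<nu>)})"

definition bounded_lipschitz_domain :: "'a::euclidean_space set \<Rightarrow> bool" where
  "bounded_lipschitz_domain \<Omega> \<longleftrightarrow>
    open \<Omega> \<and> connected \<Omega> \<and> \<Omega> \<noteq> {} \<and> bounded \<Omega> \<and> lipschitz_boundary \<Omega>"

primrec C_k :: "nat \<Rightarrow> ('a::euclidean_space \<Rightarrow> real) \<Rightarrow> bool" where
  "C_k 0 f \<longleftrightarrow> continuous_on UNIV f"
| "C_k (Suc k) f \<longleftrightarrow>
    (\<exists>D. (\<forall>x. (f has_derivative D x) (at x)) \<and> (\<forall>b\<in>Basis. C_k k (\<lambda>x. D x b)))"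

definition test_functions :: "'a::euclidean_space set \<Rightarrow> ('a \<Rightarrow> real) set" where
  "test_functions \<Omega> =
    {\<phi>. (\<forall>k. C_k k \<phi>) \<and> compact (closure {x. \<phi> x \<noteq> 0}) \<and> closure {x. \<phi> x \<noteq> 0} \<subseteq> \<Omega>}"

text \<open>Growth conditions on \<open>h = g(x,y,\<cdot>)\<close>. A Lipschitz function has a derivative
  only almost everywhere, so the two-sided bound is imposed at almost every \<open>r > 0\<close>.\<close>

definition growth_conditions :: "real \<Rightarrow> real \<Rightarrow> (real \<Rightarrow> real) \<Rightarrow> bool" where
  "growth_conditions gl gu h \<longleftrightarrow>
    ((\<lambda>r. r * h r) \<longlongrightarrow> 0) (at_right 0) \<and>
    filterlim (\<lambda>r. r * h r) at_top at_top \<and>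
    (AE r in lborel. r > 0 \<longrightarrow> h differentiable (at r) \<and>
       gl \<le> r * deriv h r / h r + 1 \<and> r * deriv h r / h r + 1 \<le> gu)"

text \<open>The standing assumptions on \<open>g\<close>, with \<open>gl\<close>, \<open>gu\<close> for the lower and upper growth constants.
  Values of \<open>g x y r\<close> for \<open>r \<le> 0\<close> are irrelevant. Lipschitz continuity in \<open>r\<close> is local in
  \<open>(0,\<infinity>)\<close>, so that powers \<open>r powr (p - 2)\<close> with \<open>p > 1\<close> are included. The diagonal is a null set
  of the product space, but \<open>G(x,x,\<cdot>)\<close> defines the space of functions of \<open>x\<close>; hence measurability
  and the growth conditions are also required of \<open>g(x,x,\<cdot>)\<close>, for almost every \<open>x\<close>.\<close>

definition admissible_kernel ::
    "real \<Rightarrow> real \<Rightarrow> ('a::euclidean_space \<Rightarrow> 'a \<Rightarrow> real \<Rightarrow> real) \<Rightarrow> bool" where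
  "admissible_kernel gl gu g \<longleftrightarrow>
    0 < gl \<and> gl \<le> gu \<and>
    (\<forall>x y r. r > 0 \<longrightarrow> g x y r > 0) \<and>
    (\<lambda>(x, y, r). g x y r) \<in> borel_measurable (lebesgue_on (UNIV \<times> UNIV \<times> {0<..})) \<and>
    (\<lambda>(x, r). g x x r) \<in> borel_measurable (lebesgue_on (UNIV \<times> {0<..})) \<and>
    (\<forall>x y a b. 0 < a \<and> a < b \<longrightarrow> (\<exists>L. L-lipschitz_on {a..b} (g x y))) \<and>
    (AE (x, y) in lebesgue. growth_conditions gl gu (g x y)) \<and>
    (AE x in lebesgue. growth_conditions gl gu (g x x))"

definition bigG :: "('a::euclidean_space \<Rightarrow> 'a \<Rightarrow> real \<Rightarrow> real) \<Rightarrow> 'a \<Rightarrow> 'a \<Rightarrow> real \<Rightarrow> real" where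
  "bigG g x y r = integral {0..r} (\<lambda>\<rho>. \<rho> * g x y \<rho>)"

text \<open>In \<open>frac_diff\<close> and in the integrals below, the value on the diagonal \<open>x = y\<close> (division by
  zero) does not matter, since the diagonal is a null set.\<close>

definition frac_diff :: "real \<Rightarrow> ('a::euclidean_space \<Rightarrow> real) \<Rightarrow> 'a \<Rightarrow> 'a \<Rightarrow> real" where
  "frac_diff s u x y = (u x - u y) / norm (x - y) powr s"

definition modular_G ::
    "('a::euclidean_space \<Rightarrow> 'a \<Rightarrow> real \<Rightarrow> real) \<Rightarrow> ('a \<Rightarrow> real) \<Rightarrow> ennreal" where
  "modular_G g u = (\<integral>\<^sup>+ x. ennreal (bigG g x x \<bar>u x\<bar>) \<partial>lebesgue)"

definition modular_sG ::
    "real \<Rightarrow> ('a::euclidean_space \<Rightarrow> 'a \<Rightarrow> real \<Rightarrow> real) \<Rightarrow> ('a \<Rightarrow> real) \<Rightarrow> ennreal" where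
  "modular_sG s g u =
    (\<integral>\<^sup>+ (x, y). ennreal (bigG g x y \<bar>frac_diff s u x y\<bar> / norm (x - y) ^ DIM('a)) \<partial>lebesgue)"

definition L_G :: "('a::euclidean_space \<Rightarrow> 'a \<Rightarrow> real \<Rightarrow> real) \<Rightarrow> ('a \<Rightarrow> real) set" where
  "L_G g = {u \<in> borel_measurable lebesgue. modular_G g u < \<infinity>}"

definition W_sG :: "real \<Rightarrow> ('a::euclidean_space \<Rightarrow> 'a \<Rightarrow> real \<Rightarrow> real) \<Rightarrow> ('a \<Rightarrow> real) set" where
  "W_sG s g = {u \<in> L_G g. modular_sG s g u < \<infinity>}"

text \<open>On \<open>W_sG s g\<close> the sets below are nonempty, so the real infima are the intended ones.\<close>

definition norm_G :: "('a::euclidean_space \<Rightarrow> 'a \<Rightarrow> real \<Rightarrow> real) \<Rightarrow> ('a \<Rightarrow> real) \<Rightarrow> real" where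
  "norm_G g u = Inf {l. l > 0 \<and> modular_G g (\<lambda>x. u x / l) \<le> 1}"

definition seminorm_sG ::
    "real \<Rightarrow> ('a::euclidean_space \<Rightarrow> 'a \<Rightarrow> real \<Rightarrow> real) \<Rightarrow> ('a \<Rightarrow> real) \<Rightarrow> real" where
  "seminorm_sG s g u = Inf {l. l > 0 \<and> modular_sG s g (\<lambda>x. u x / l) \<le> 1}"

definition norm_sG ::
    "real \<Rightarrow> ('a::euclidean_space \<Rightarrow> 'a \<Rightarrow> real \<Rightarrow> real) \<Rightarrow> ('a \<Rightarrow> real) \<Rightarrow> real" where
  "norm_sG s g u = norm_G g u + seminorm_sG s g u"

text \<open>The closure is taken in \<open>W_sG s g\<close>, of those test functions that belong to it; if
  all of them do, this is no restriction.\<close>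

definition W0_sG ::
    "real \<Rightarrow> ('a::euclidean_space \<Rightarrow> 'a \<Rightarrow> real \<Rightarrow> real) \<Rightarrow> 'a set \<Rightarrow> ('a \<Rightarrow> real) set" where
  "W0_sG s g \<Omega> =
    {u \<in> W_sG s g. (AE x in lebesgue. x \<notin> \<Omega> \<longrightarrow> u x = 0) \<and>
       (\<forall>\<epsilon>>0. \<exists>\<phi> \<in> test_functions \<Omega> \<inter> W_sG s g. norm_sG s g (\<lambda>x. u x - \<phi> x) < \<epsilon>)}"

text \<open>A functional is a map on all functions of which only the restriction to \<open>W0_sG s g \<Omega>\<close>
  matters; the pairing of \<open>F\<close> with \<open>v\<close> is the application \<open>F v\<close>.\<close>

definition dual_W0 ::
    "real \<Rightarrow> ('a::euclidean_space \<Rightarrow> 'a \<Rightarrow> real \<Rightarrow> real) \<Rightarrow> 'a set \<Rightarrow> (('a \<Rightarrow> real) \<Rightarrow> real) set" where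
  "dual_W0 s g \<Omega> =
    {F. (\<forall>u \<in> W0_sG s g \<Omega>. \<forall>v \<in> W0_sG s g \<Omega>. F (\<lambda>x. u x + v x) = F u + F v) \<and>
        (\<forall>c. \<forall>v \<in> W0_sG s g \<Omega>. F (\<lambda>x. c * v x) = c * F v) \<and>
        (\<exists>C. \<forall>v \<in> W0_sG s g \<Omega>. \<bar>F v\<bar> \<le> C * norm_sG s g v)}"

definition dual_nonneg ::
    "real \<Rightarrow> ('a::euclidean_space \<Rightarrow> 'a \<Rightarrow> real \<Rightarrow> real) \<Rightarrow> 'a set \<Rightarrow> (('a \<Rightarrow> real) \<Rightarrow> real) \<Rightarrow> bool" where
  "dual_nonneg s g \<Omega> F \<longleftrightarrow>
    (\<forall>v \<in> W0_sG s g \<Omega>. (AE x in lebesgue. 0 \<le> v x) \<longrightarrow> 0 \<le> F v)"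

definition dual_ge ::
    "real \<Rightarrow> ('a::euclidean_space \<Rightarrow> 'a \<Rightarrow> real \<Rightarrow> real) \<Rightarrow> 'a set \<Rightarrow>
     (('a \<Rightarrow> real) \<Rightarrow> real) \<Rightarrow> (('a \<Rightarrow> real) \<Rightarrow> real) \<Rightarrow> bool" where
  "dual_ge s g \<Omega> F F' \<longleftrightarrow> dual_nonneg s g \<Omega> (\<lambda>v. F v - F' v)"

definition frac_g_laplacian ::
    "real \<Rightarrow> ('a::euclidean_space \<Rightarrow> 'a \<Rightarrow> real \<Rightarrow> real) \<Rightarrow> ('a \<Rightarrow> real) \<Rightarrow> ('a \<Rightarrow> real) \<Rightarrow> real" where
  "frac_g_laplacian s g u v =
    (\<integral> (x, y). g x y \<bar>frac_diff s u x y\<bar> * frac_diff s u x y * frac_diff s v x y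
       / norm (x - y) ^ DIM('a) \<partial>lebesgue)"

definition dirichlet_solution ::
    "real \<Rightarrow> ('a::euclidean_space \<Rightarrow> 'a \<Rightarrow> real \<Rightarrow> real) \<Rightarrow> 'a set \<Rightarrow>
     (('a \<Rightarrow> real) \<Rightarrow> real) \<Rightarrow> ('a \<Rightarrow> real) \<Rightarrow> bool" where
  "dirichlet_solution s g \<Omega> F u \<longleftrightarrow>
    u \<in> W0_sG s g \<Omega> \<and> (\<forall>v \<in> W0_sG s g \<Omega>. frac_g_laplacian s g u v = F v)"

end

theory Submission
  imports Defs
begin

text \<open>Write \<open>A t = t * g x y \<bar>t\<bar>\<close>; the lower growth bound makes \<open>A\<close> strictly increasing. Test the
  difference of the two equations with the positive part \<open>v\<close> of \<open>u' - u\<close>. At each pair of points the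
  integrand \<open>(A (\<delta> u') - A (\<delta> u)) * \<delta> v\<close> is nonnegative, since a positive part varies in the same
  direction as the function, while its integral is nonpositive by the order of the data. So it vanishes
  almost everywhere, which forces \<open>v x = v y\<close> for almost all pairs; as \<open>v\<close> vanishes outside the
  bounded set \<open>\<Omega>\<close>, it is zero.

  The point that needs work is that \<open>v\<close> is an admissible test function. If test functions \<open>\<phi> n\<close>, \<open>\<psi> n\<close>
  approximate \<open>u'\<close>, \<open>u\<close> fast enough for the modulars of the errors to be summable, then smoothed
  positive parts of \<open>\<phi> n - \<psi> n\<close> are again test functions and converge to \<open>v\<close> in modular, by
  dominated convergence. The upper growth bound gives the doubling property, hence modular
  convergence is convergence in norm. Mollification would not do: without regularity of \<open>g\<close> in
  \<open>x\<close> and \<open>y\<close> it need not be continuous in these spaces.\<close>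

subsection \<open>Growth of the kernel\<close>

text \<open>The exceptional null set lies in an open set \<open>U\<close> of small measure; there the possible decrease
  is charged to \<open>L\<close> times the measure of \<open>U\<close>, elsewhere to \<open>\<epsilon>\<close> times the length.\<close>

lemma lipschitz_AE_deriv_nonneg_imp_le:
  fixes f :: "real \<Rightarrow> real"
  assumes ab: "a \<le> b" and lip: "L-lipschitz_on {a..b} f"
    and deriv: "AE r in lborel. a < r \<and> r < b \<longrightarrow> f differentiable (at r) \<and> 0 \<le> deriv f r"
  shows "f a \<le> f b"
proof -
  \<comment> \<open>The endpoints join the exceptional set: the hypothesis covers only the open
    interval, while the bisection below also visits \<open>a\<close> and \<open>b\<close>.\<close>
  define N where "N = {r. \<not> (a < r \<and> r < b \<longrightarrow> f differentiable (at r) \<and> 0 \<le> deriv f r)} \<union> {a, b}"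
  have "AE r in lebesgue. a < r \<and> r < b \<longrightarrow> f differentiable (at r) \<and> 0 \<le> deriv f r"
    using deriv by (simp add: AE_completion_iff)
  then have "negligible N"
    unfolding N_def eventually_ae_filter_negligible
    by (metis negligible_Un negligible_finite finite.emptyI finite_insert negligible_subset)
  then have N: "N \<in> null_sets lebesgue"
    by (simp add: negligible_iff_null_sets)
  have L0: "0 \<le> L" using lip lipschitz_on_nonneg by blast
  have bound: "f a - f b \<le> \<epsilon> * (b - a) + L * \<epsilon>" if eps: "0 < \<epsilon>" for \<epsilon>
  proof -
    obtain U where U: "open U" "N \<subseteq> U" "U - N \<in> lmeasurable"
        "emeasure lebesgue (U - N) < ennreal \<epsilon>"
      using sets_lebesgue_outer_open[OF null_setsD2[OF N] eps] by metis
    have Um: "U \<in> lmeasurable"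
      using U(3) fmeasurableI_null_sets[OF N] U(2)
      by (metis Diff_partition fmeasurable.Un)
    have "measure lebesgue U = measure lebesgue (U - N)"
      using N Um by (simp add: measure_Diff_null_set fmeasurableD)
    also have "\<dots> \<le> \<epsilon>"
      using U(4) eps by (simp add: measure_def enn2real_leI less_imp_le)
    finally have Ueps: "measure lebesgue U \<le> \<epsilon>" .
    have I: "U \<inter> {u<..v} \<in> lmeasurable" for u v :: real
      using Um by (intro fmeasurable_Int_fmeasurable) auto
    define m where "m u v = measure lebesgue (U \<inter> {u<..v})" for u v
    have m_add: "m u w = m u v + m v w" if "u \<le> v" "v \<le> w" for u v w
    proof -
      have "U \<inter> {u<..w} = (U \<inter> {u<..v}) \<union> (U \<inter> {v<..w})" using that by auto
      moreover have "(U \<inter> {u<..v}) \<inter> (U \<inter> {v<..w}) = {}" by auto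
      ultimately show ?thesis
        unfolding m_def using I by (simp add: measure_Un2 fmeasurableD Diff_triv inf_commute)
    qed
    have m0: "0 \<le> m u v" for u v by (simp add: m_def)
    \<comment> \<open>Both terms of the bound are additive over adjacent intervals, so
      \<open>Bolzano\<close> reduces it to short intervals around each point. The premise, trivial
      for \<open>a\<close> and \<open>b\<close> themselves, keeps the subintervals inside
      \<open>{a..b}\<close>, where \<open>f\<close> is Lipschitz.\<close>
    have "a \<le> a \<and> b \<le> b \<longrightarrow> f a - f b \<le> \<epsilon> * (b - a) + L * m a b"
      using ab
    proof (induction a b rule: Bolzano[where P="\<lambda>u v. a \<le> u \<and> v \<le> b \<longrightarrow> f u - f v \<le> \<epsilon> * (v - u) + L * m u v"])
      case (trans u v w)
      have "m u w = m u v + m v w" using trans by (intro m_add) auto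
      then show ?case using trans by (auto simp: algebra_simps)
    next
      case (local x)
      show ?case
      proof (cases "x \<in> N")
        case True
        then obtain d where d: "d > 0" "ball x d \<subseteq> U" using U(1,2) open_contains_ball by (metis subsetD)
        show ?thesis
        proof (intro exI[of _ d] conjI d(1) allI impI)
          fix u v assume uv: "u \<le> x \<and> x \<le> v \<and> v - u < d" and ab': "a \<le> u \<and> v \<le> b"
          have "{u<..v} \<subseteq> U" using d(2) uv by (auto simp: subset_eq dist_real_def)
          then have "m u v = v - u" using uv by (simp add: m_def Int_absorb1)
          moreover have "\<bar>f u - f v\<bar> \<le> L * \<bar>u - v\<bar>"
            using lipschitz_onD[OF lip, of u v] uv ab' by (auto simp: dist_real_def)
          ultimately show "f u - f v \<le> \<epsilon> * (v - u) + L * m u v"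
            using uv eps by (smt (verit) mult_nonneg_nonneg)
        qed
      next
        case False
        then have x: "f differentiable (at x)" "0 \<le> deriv f x" using local by (auto simp: N_def)
        then have "(f has_derivative (*) (deriv f x)) (at x)"
          by (metis DERIV_deriv_iff_real_differentiable has_field_derivative_def)
        then obtain d where d: "d > 0"
          "\<And>y. norm (y - x) < d \<Longrightarrow> norm (f y - f x - deriv f x * (y - x)) \<le> \<epsilon> * norm (y - x)"
          using eps unfolding has_derivative_at_alt by metis
        show ?thesis
        proof (intro exI[of _ d] conjI d(1) allI impI)
          fix u v assume uv: "u \<le> x \<and> x \<le> v \<and> v - u < d" and ab': "a \<le> u \<and> v \<le> b"
          have "norm (f v - f x - deriv f x * (v - x)) \<le> \<epsilon> * norm (v - x)"
            "norm (f u - f x - deriv f x * (u - x)) \<le> \<epsilon> * norm (u - x)"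
            using d(2)[of v] d(2)[of u] uv by auto
          moreover have "0 \<le> deriv f x * (v - x)" "0 \<le> deriv f x * (x - u)"
            using x uv by auto
          moreover have "0 \<le> L * m u v" using L0 m0 by simp
          ultimately show "f u - f v \<le> \<epsilon> * (v - u) + L * m u v"
            using uv by (auto simp: algebra_simps abs_if split: if_splits)
        qed
      qed
    qed
    moreover have "m a b \<le> measure lebesgue U"
      unfolding m_def using Um I by (intro measure_mono_fmeasurable) (auto simp: fmeasurableD)
    ultimately show ?thesis
      using Ueps L0 by (smt (verit) mult_left_mono)
  qed
  show ?thesis
  proof (rule ccontr)
    assume "\<not> f a \<le> f b"
    \<comment> \<open>With this \<open>e\<close> the bound is at most half of
      \<open>f a - f b\<close>; the summand 1 keeps the denominator positive when
      \<open>a = b\<close> and \<open>L = 0\<close>.\<close>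
    define e where "e = (f a - f b) / (2 * (b - a + L + 1))"
    have p: "0 < b - a + L + 1" using ab L0 by linarith
    then have "0 < e" using \<open>\<not> f a \<le> f b\<close> by (simp add: e_def)
    then have "f a - f b \<le> e * (b - a + L)" using bound[of e] by (simp add: algebra_simps)
    also have "\<dots> \<le> e * (b - a + L + 1)" using \<open>0 < e\<close> by (simp add: algebra_simps)
    also have "\<dots> = (f a - f b) / 2" using p by (simp add: e_def field_simps)
    finally show False using \<open>\<not> f a \<le> f b\<close> by simp
  qed
qed

lemma lipschitz_on_ln:
  fixes m :: real
  assumes "0 < m"
  shows "(1 / m)-lipschitz_on {m..} ln"
proof (rule lipschitz_onI)
  fix x y :: real assume xy: "x \<in> {m..}" "y \<in> {m..}"
  have *: "ln v - ln u \<le> (1 / m) * (v - u)" if "m \<le> u" "u \<le> v" for u v :: real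
  proof -
    have "ln v - ln u \<le> (v - u) / u" using that assms by (intro ln_diff_le) auto
    also have "\<dots> \<le> (1 / m) * (v - u)" using that assms by (simp add: frac_le)
    finally show ?thesis .
  qed
  have mono: "u \<le> v \<Longrightarrow> m \<le> u \<Longrightarrow> ln u \<le> ln v" for u v :: real using assms by simp
  show "dist (ln x) (ln y) \<le> (1 / m) * dist x y"
    using *[of x y] *[of y x] mono[of x y] mono[of y x] xy
    by (cases "x \<le> y") (auto simp: dist_real_def)
qed (use assms in auto)

text \<open>The growth bounds control the logarithmic derivative; \<open>\<sigma> = 1\<close> is used for the lower and
  \<open>\<sigma> = -1\<close> for the upper one.\<close>

lemma log_kernel_mono:
  fixes k :: "real \<Rightarrow> real"
  assumes pos: "\<And>r. 0 < r \<Longrightarrow> 0 < k r"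
    and lip: "\<And>a b. 0 < a \<Longrightarrow> a < b \<Longrightarrow> \<exists>L. L-lipschitz_on {a..b} k"
    and deriv: "AE r in lborel. 0 < r \<longrightarrow> k differentiable (at r) \<and> 0 \<le> \<sigma> * (r * deriv k r / k r) + c"
    and ab: "0 < a" "a < b"
  shows "\<sigma> * ln (k a) + c * ln a \<le> \<sigma> * ln (k b) + c * ln b"
proof -
  obtain L where L: "L-lipschitz_on {a..b} k" using lip ab by blast
  \<comment> \<open>The logarithm is Lipschitz only away from 0, so \<open>k\<close> needs a
    positive lower bound on the interval; its minimum provides one.\<close>
  have "compact (k ` {a..b})" "k ` {a..b} \<noteq> {}"
    using ab lipschitz_on_continuous_on[OF L] by (auto intro: compact_continuous_image)
  then obtain r0 where r0: "r0 \<in> {a..b}" "\<And>r. r \<in> {a..b} \<Longrightarrow> k r0 \<le> k r"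
    using compact_attains_inf[of "k ` {a..b}"] by auto
  have m: "0 < k r0" using pos r0 ab by auto
  have "k ` {a..b} \<subseteq> {k r0..}" using r0(2) by auto
  have l1: "(1 / k r0 * L)-lipschitz_on {a..b} (\<lambda>r. ln (k r))"
    by (rule lipschitz_on_compose2[OF L lipschitz_on_subset[OF lipschitz_on_ln[OF m]]]) fact
  have l2: "(1 / a)-lipschitz_on {a..b} ln"
    by (rule lipschitz_on_subset[OF lipschitz_on_ln]) (use ab in auto)
  have l: "\<exists>M. M-lipschitz_on {a..b} (\<lambda>r. \<sigma> * ln (k r) + c * ln r)"
    using lipschitz_on_add[OF lipschitz_on_cmult_real[OF l1, of \<sigma>] lipschitz_on_cmult_real[OF l2, of c]]
    by blast
  have "AE r in lborel. a < r \<and> r < b \<longrightarrow> (\<lambda>r. \<sigma> * ln (k r) + c * ln r) differentiable (at r) \<and>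
      0 \<le> deriv (\<lambda>r. \<sigma> * ln (k r) + c * ln r) r"
    using deriv
  proof eventually_elim
    case (elim r)
    show ?case
    proof
      assume "a < r \<and> r < b"
      then have r: "0 < r" "0 < k r" using ab pos by auto
      have "(k has_real_derivative deriv k r) (at r)"
        using elim r by (simp add: DERIV_deriv_iff_real_differentiable)
      then have D: "((\<lambda>r. \<sigma> * ln (k r) + c * ln r) has_real_derivative
          \<sigma> * (deriv k r / k r) + c * (1 / r)) (at r)"
        using r by (auto intro!: derivative_eq_intros)
      have "\<sigma> * (deriv k r / k r) + c * (1 / r) = (\<sigma> * (r * deriv k r / k r) + c) / r"
        using r by (simp add: field_simps)
      then have "0 \<le> \<sigma> * (deriv k r / k r) + c * (1 / r)" using elim r by simp
      with D show "(\<lambda>r. \<sigma> * ln (k r) + c * ln r) differentiable (at r) \<and>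
          0 \<le> deriv (\<lambda>r. \<sigma> * ln (k r) + c * ln r) r"
        by (auto simp: DERIV_imp_deriv real_differentiable_def)
    qed
  qed
  with l lipschitz_AE_deriv_nonneg_imp_le[of a b _ "\<lambda>r. \<sigma> * ln (k r) + c * ln r"] ab
  show ?thesis by auto
qed

section \<open>The flux \<open>r * k r\<close> and its primitive: monotonicity, scaling,
  doubling\<close>

definition flux_primitive :: "(real \<Rightarrow> real) \<Rightarrow> real \<Rightarrow> real" where
  "flux_primitive k r = integral {0..r} (\<lambda>\<rho>. \<rho> * k \<rho>)"

text \<open>The kernel frozen at one point. Since \<open>growth\<close> is known only almost
  everywhere, this locale is later interpreted inside almost everywhere arguments.\<close>

locale growth_kernel =
  fixes gl gu :: real and k :: "real \<Rightarrow> real"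
  assumes gl: "0 < gl" and gu: "gl \<le> gu"
    and pos: "\<And>r. 0 < r \<Longrightarrow> 0 < k r"
    and lip: "\<And>a b. 0 < a \<Longrightarrow> a < b \<Longrightarrow> \<exists>L. L-lipschitz_on {a..b} k"
    and growth: "growth_conditions gl gu k"
begin

abbreviation H :: "real \<Rightarrow> real" where "H \<equiv> flux_primitive k"

text \<open>The choice \<open>c = 1 - gl\<close> in \<open>log_kernel_mono\<close> makes
  \<open>ln (r * k r) - gl * ln r\<close> nondecreasing.\<close>

lemma flux_lower:
  assumes "0 < a" "a < b"
  shows "(b / a) powr gl * (a * k a) \<le> b * k b"
proof -
  have "AE r in lborel. 0 < r \<longrightarrow> k differentiable (at r) \<and> 0 \<le> 1 * (r * deriv k r / k r) + (1 - gl)"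
    using growth unfolding growth_conditions_def by (auto elim!: eventually_mono)
  from log_kernel_mono[OF pos lip this assms]
  have "ln (k a) + (1 - gl) * ln a \<le> ln (k b) + (1 - gl) * ln b" by simp
  then have "gl * ln (b / a) + ln (a * k a) \<le> ln (b * k b)"
    using assms pos[of a] pos[of b] by (simp add: ln_mult ln_div algebra_simps)
  then have "ln ((b / a) powr gl * (a * k a)) \<le> ln (b * k b)"
    using assms pos[of a] pos[of b] by (simp add: ln_mult ln_powr)
  then show ?thesis using assms pos[of a] pos[of b] by simp
qed

text \<open>Dually, \<open>ln (r * k r) - gu * ln r\<close> is nonincreasing.\<close>

lemma flux_upper:
  assumes "0 < a" "a < b"
  shows "b * k b \<le> (b / a) powr gu * (a * k a)"
proof -
  have "AE r in lborel. 0 < r \<longrightarrow> k differentiable (at r) \<and> 0 \<le> (-1) * (r * deriv k r / k r) + (gu - 1)"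
    using growth unfolding growth_conditions_def by (auto elim!: eventually_mono)
  from log_kernel_mono[OF pos lip this assms]
  have "- ln (k a) + (gu - 1) * ln a \<le> - ln (k b) + (gu - 1) * ln b" by simp
  then have "ln (b * k b) \<le> gu * ln (b / a) + ln (a * k a)"
    using assms pos[of a] pos[of b] by (simp add: ln_mult ln_div algebra_simps)
  then have "ln (b * k b) \<le> ln ((b / a) powr gu * (a * k a))"
    using assms pos[of a] pos[of b] by (simp add: ln_mult ln_powr)
  then show ?thesis using assms pos[of a] pos[of b] by simp
qed

text \<open>For \<open>a > 0\<close> strictness comes from \<open>0 < gl\<close>, as
  \<open>(b / a) powr gl\<close> then exceeds 1.\<close>

lemma flux_strict_mono:
  assumes "0 \<le> a" "a < b"
  shows "a * k a < b * k b"
proof (cases "a = 0")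
  case True
  then show ?thesis using assms pos[of b] by simp
next
  case False
  with assms have a: "0 < a" by simp
  then have "1 < (b / a) powr gl" using assms gl by (simp add: gr_one_powr)
  then have "1 * (a * k a) < (b / a) powr gl * (a * k a)"
    using a pos[of a] by (intro mult_strict_right_mono) auto
  also note flux_lower[OF a assms(2)]
  finally show ?thesis by simp
qed

lemma flux_mono: "0 \<le> a \<Longrightarrow> a \<le> b \<Longrightarrow> a * k a \<le> b * k b"
  using flux_strict_mono[of a b] by (cases "a = b") auto

lemma flux_nonneg: "0 \<le> a \<Longrightarrow> 0 \<le> a * k a"
  using flux_mono[of 0 a] by simp

lemma flux_scale_upper:
  assumes "1 \<le> c" "0 \<le> r"
  shows "(c * r) * k (c * r) \<le> c powr gu * (r * k r)"
proof (cases "r = 0 \<or> c = 1")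
  case False
  then show ?thesis using flux_upper[of r "c * r"] assms by simp
qed auto

text \<open>Integrability comes from monotonicity of the flux, so a kernel that blows up at 0 causes
  no difficulty.\<close>

lemma flux_integrable: "(\<lambda>\<rho>. \<rho> * k \<rho>) integrable_on {0..r}"
  by (intro integrable_on_mono_on mono_onI flux_mono) auto

lemma H_0: "H 0 = 0" by (simp add: flux_primitive_def)

lemma H_mono: "0 \<le> a \<Longrightarrow> a \<le> b \<Longrightarrow> H a \<le> H b"
  unfolding flux_primitive_def by (intro integral_subset_le flux_integrable) (use flux_nonneg in auto)

lemma H_nonneg: "0 \<le> H a"
  \<comment> \<open>For negative \<open>a\<close> the interval of integration is empty and the
    integral is 0.\<close>
  using H_mono[of 0 a] H_0 by (cases "0 \<le> a") (auto simp: flux_primitive_def)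

text \<open>Substituting \<open>c * \<rho>\<close> moves the integral to the interval of
  \<open>H r\<close>, so that pointwise bounds on the flux become scaling bounds on
  \<open>H\<close>.\<close>

lemma H_scale:
  assumes "1 \<le> c" "0 \<le> r"
  shows "H (c * r) = c * integral {0..r} (\<lambda>\<rho>. (c * \<rho>) * k (c * \<rho>))"
    and "(\<lambda>\<rho>. (c * \<rho>) * k (c * \<rho>)) integrable_on {0..r}"
proof -
  have "((\<lambda>\<rho>. \<rho> * k \<rho>) has_integral H (c * r)) (cbox 0 (c * r))"
    using flux_integrable[of "c * r"] by (simp add: flux_primitive_def integrable_integral)
  from has_integral_affinity[OF this, of c 0]
  have "((\<lambda>\<rho>. (c * \<rho>) * k (c * \<rho>)) has_integral (1 / c) * H (c * r)) ((\<lambda>x. (1 / c) *\<^sub>R x) ` {0..c * r})"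
    using assms by simp
  moreover have "(\<lambda>x. (1 / c) *\<^sub>R x) ` {0..c * r} = {0..r}"
    using image_mult_atLeastAtMost[of "1 / c" 0 "c * r"] assms by auto
  ultimately have *: "((\<lambda>\<rho>. (c * \<rho>) * k (c * \<rho>)) has_integral (1 / c) * H (c * r)) {0..r}"
    by simp
  show "H (c * r) = c * integral {0..r} (\<lambda>\<rho>. (c * \<rho>) * k (c * \<rho>))"
    using integral_unique[OF *] assms by simp
  show "(\<lambda>\<rho>. (c * \<rho>) * k (c * \<rho>)) integrable_on {0..r}" using * by blast
qed

lemma H_scale_lower:
  assumes "1 \<le> c" "0 \<le> r"
  shows "c * H r \<le> H (c * r)"
proof -
  have "H r \<le> integral {0..r} (\<lambda>\<rho>. (c * \<rho>) * k (c * \<rho>))"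
    unfolding flux_primitive_def
  proof (intro integral_le flux_integrable H_scale(2) assms)
    fix x assume "x \<in> {0..r}"
    then show "x * k x \<le> c * x * k (c * x)"
      using assms by (intro flux_mono) (auto simp: mult_le_cancel_right1)
  qed
  then show ?thesis using assms by (simp add: H_scale(1) mult_left_mono)
qed

text \<open>The doubling property: the flux contributes the power \<open>gu\<close> and the
  substitution one more factor \<open>c\<close>.\<close>

lemma H_scale_upper:
  assumes "1 \<le> c" "0 \<le> r"
  shows "H (c * r) \<le> c powr (gu + 1) * H r"
proof -
  have "integral {0..r} (\<lambda>\<rho>. (c * \<rho>) * k (c * \<rho>)) \<le> integral {0..r} (\<lambda>\<rho>. c powr gu * (\<rho> * k \<rho>))"
  proof (intro integral_le H_scale(2) assms)
    show "(\<lambda>\<rho>. c powr gu * (\<rho> * k \<rho>)) integrable_on {0..r}"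
      using integrable_cmul[OF flux_integrable, of "c powr gu"] by simp
    fix x assume "x \<in> {0..r}"
    then show "c * x * k (c * x) \<le> c powr gu * (x * k x)"
      using assms by (intro flux_scale_upper) auto
  qed
  also have "\<dots> = c powr gu * H r" by (simp add: flux_primitive_def)
  finally have "c * integral {0..r} (\<lambda>\<rho>. (c * \<rho>) * k (c * \<rho>)) \<le> c * (c powr gu * H r)"
    using assms by (intro mult_left_mono) auto
  then show ?thesis using assms by (simp add: H_scale(1) powr_add mult_ac)
qed

text \<open>On \<open>{r..2 * r}\<close> the flux is at least its value at \<open>r\<close>, so
  \<open>r\<close> times that value is at most \<open>H (2 * r)\<close>; doubling leads back to
  \<open>H r\<close>.\<close>

lemma flux_le_H:
  assumes "0 \<le> r"
  shows "r * (r * k r) \<le> 2 powr (gu + 1) * H r"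
proof -
  have "integral {r..2 * r} (\<lambda>\<rho>. r * k r) \<le> integral {r..2 * r} (\<lambda>\<rho>. \<rho> * k \<rho>)"
    using assms by (intro integral_le integrable_on_subinterval[OF flux_integrable[of "2 * r"]] flux_mono) auto
  also have "\<dots> \<le> H (2 * r)"
    unfolding flux_primitive_def using assms
    by (intro integral_subset_le flux_integrable integrable_on_subinterval[OF flux_integrable[of "2 * r"]])
       (use flux_nonneg in auto)
  also have "\<dots> \<le> 2 powr (gu + 1) * H r" using assms by (intro H_scale_upper) auto
  finally show ?thesis using assms by simp
qed

lemma H_le_flux:
  assumes "0 \<le> r"
  shows "H r \<le> r * (r * k r)"
proof -
  have "H r \<le> integral {0..r} (\<lambda>\<rho>. r * k r)"
    unfolding flux_primitive_def using assms by (intro integral_le flux_integrable flux_mono) auto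
  then show ?thesis using assms by simp
qed

text \<open>A substitute for Young's inequality that avoids the conjugate function: both arguments
  are raised to \<open>max r t\<close>, where \<open>flux_le_H\<close> applies.\<close>

lemma flux_mult_le:
  assumes "0 \<le> r" "0 \<le> t"
  shows "(r * k r) * t \<le> 2 powr (gu + 1) * (H r + H t)"
proof -
  define m where "m = max r t"
  have m: "0 \<le> m" "r \<le> m" "t \<le> m" using assms by (auto simp: m_def)
  have "(r * k r) * t \<le> (m * k m) * m"
    using m assms by (intro mult_mono flux_mono flux_nonneg) auto
  also have "\<dots> \<le> 2 powr (gu + 1) * H m" using flux_le_H[OF m(1)] by (simp add: mult_ac)
  also have "\<dots> \<le> 2 powr (gu + 1) * (H r + H t)"
    using H_nonneg[of r] H_nonneg[of t] by (intro mult_left_mono) (auto simp: m_def max_def)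
  finally show ?thesis .
qed

lemma H_pos:
  assumes "0 < r" shows "0 < H r"
  using flux_le_H[of r] assms pos[of r] by (smt (verit) mult_pos_pos powr_gt_zero zero_less_mult_pos)

lemma H_tendsto_0:
  assumes "(t \<longlongrightarrow> 0) F" "\<And>i. 0 \<le> t i"
  shows "((\<lambda>i. H (t i)) \<longlongrightarrow> 0) F"
proof -
  have ev: "eventually (\<lambda>i. t i < 1) F" using assms(1) by (rule order_tendstoD) simp
  show ?thesis
  proof (rule tendsto_sandwich[of "\<lambda>_. 0" _ _ "\<lambda>i. t i * (1 * k 1)"])
    show "\<forall>\<^sub>F i in F. H (t i) \<le> t i * (1 * k 1)"
      using ev
    proof eventually_elim
      case (elim i)
      have "H (t i) \<le> t i * (t i * k (t i))" using assms H_le_flux by auto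
      also have "\<dots> \<le> t i * (1 * k 1)" using elim assms by (intro mult_left_mono flux_mono) auto
      finally show ?case .
    qed
  qed (use assms(1) H_nonneg in \<open>auto intro: tendsto_mult_left_zero\<close>)
qed

lemma tendsto_0_if_H_tendsto_0:
  assumes "((\<lambda>i. H (t i)) \<longlongrightarrow> 0) F" "\<And>i. 0 \<le> t i"
  shows "(t \<longlongrightarrow> 0) F"
proof (rule tendstoI)
  fix e :: real assume e: "0 < e"
  from assms(1) have "eventually (\<lambda>i. H (t i) < H e) F" using H_pos[OF e] by (rule order_tendstoD)
  then show "eventually (\<lambda>i. dist (t i) 0 < e) F"
  proof eventually_elim
    case (elim i)
    then show ?case using H_mono[of e "t i"] e assms(2)[of i] by (cases "t i < e") auto
  qed
qed

text \<open>A quasi-triangle inequality from doubling, as \<open>t\<close> is at most twice the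
  larger of \<open>a\<close> and \<open>b\<close>.\<close>

lemma H_add_le:
  assumes "0 \<le> a" "0 \<le> b" "0 \<le> t" "t \<le> a + b"
  shows "H t \<le> 2 powr (gu + 1) * (H a + H b)"
proof -
  have "H t \<le> H (2 * max a b)" using assms by (intro H_mono) auto
  also have "\<dots> \<le> 2 powr (gu + 1) * H (max a b)" using assms by (intro H_scale_upper) auto
  also have "\<dots> \<le> 2 powr (gu + 1) * (H a + H b)"
    using H_nonneg[of a] H_nonneg[of b] by (intro mult_left_mono) (auto simp: max_def)
  finally show ?thesis .
qed

end

lemma locally_lipschitz_continuous_on:
  fixes k :: "real \<Rightarrow> real"
  assumes lip: "\<And>a b. 0 < a \<Longrightarrow> a < b \<Longrightarrow> \<exists>L. L-lipschitz_on {a..b} k"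
  shows "continuous_on {0<..} k"
proof (rule continuous_at_imp_continuous_on, rule ballI)
  fix r :: real assume "r \<in> {0<..}"
  then have r: "0 < r / 2" "r / 2 < 2 * r" "r \<in> {r / 2<..<2 * r}" by auto
  obtain L where "L-lipschitz_on {r / 2..2 * r} k" using lip[OF r(1,2)] by blast
  then have "continuous_on {r / 2..2 * r} k" by (rule lipschitz_on_continuous_on)
  then have "continuous_on {r / 2<..<2 * r} k" by (rule continuous_on_subset) auto
  with r(3) show "isCont k r" by (simp add: continuous_on_eq_continuous_at)
qed

subsection \<open>Smooth positive part of test functions\<close>

lemma C_k_SucI:
  "(\<And>x. (f has_derivative D x) (at x)) \<Longrightarrow> (\<And>b. b \<in> Basis \<Longrightarrow> C_k k (\<lambda>x. D x b)) \<Longrightarrow> C_k (Suc k) f"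
  unfolding C_k.simps by blast

lemma C_k_SucE:
  assumes "C_k (Suc k) f"
  obtains D where "\<forall>x. (f has_derivative D x) (at x)" "\<forall>b\<in>Basis. C_k k (\<lambda>x. D x b)"
  using assms unfolding C_k.simps by blast

text \<open>Derivatives of products contain the factors themselves, which must therefore be
  available at the lower order.\<close>

lemma C_k_SucD: "C_k (Suc k) f \<Longrightarrow> C_k k f"
proof (induction k arbitrary: f)
  case 0
  then have "f differentiable (at x)" for x by (auto simp: differentiable_def)
  then show ?case
    by (simp add: continuous_at_imp_continuous_on differentiable_imp_continuous_within)
next
  case (Suc k)
  obtain D where D: "\<And>x. (f has_derivative D x) (at x)" "\<And>b. b \<in> Basis \<Longrightarrow> C_k (Suc k) (\<lambda>x. D x b)"
    using C_k_SucE[OF Suc.prems] by metis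
  show ?case by (rule C_k_SucI[OF D(1)]) (rule Suc.IH[OF D(2)])
qed

lemma C_k_const: "C_k k (\<lambda>x. c)"
proof (induction k arbitrary: c)
  case (Suc k)
  then show ?case by (intro C_k_SucI[of _ "\<lambda>x h. 0"]) auto
qed simp

lemma C_k_add:
  fixes f h :: "'a::euclidean_space \<Rightarrow> real"
  shows "C_k k f \<Longrightarrow> C_k k h \<Longrightarrow> C_k k (\<lambda>x. f x + h x)"
proof (induction k arbitrary: f h)
  case (Suc k)
  obtain D where D: "\<And>x. (f has_derivative D x) (at x)" "\<And>b. b \<in> Basis \<Longrightarrow> C_k k (\<lambda>x. D x b)"
    using C_k_SucE[OF Suc.prems(1)] by metis
  obtain E where E: "\<And>x. (h has_derivative E x) (at x)" "\<And>b. b \<in> Basis \<Longrightarrow> C_k k (\<lambda>x. E x b)"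
    using C_k_SucE[OF Suc.prems(2)] by metis
  show ?case
  proof (rule C_k_SucI[of _ "\<lambda>x b. D x b + E x b", OF has_derivative_add[OF D(1) E(1)]])
    fix b :: 'a assume "b \<in> Basis"
    then show "C_k k (\<lambda>x. D x b + E x b)" by (intro Suc.IH D(2) E(2))
  qed
qed (simp add: continuous_on_add)

lemma C_k_mult:
  fixes f h :: "'a::euclidean_space \<Rightarrow> real"
  shows "C_k k f \<Longrightarrow> C_k k h \<Longrightarrow> C_k k (\<lambda>x. f x * h x)"
proof (induction k arbitrary: f h)
  case (Suc k)
  obtain D where D: "\<And>x. (f has_derivative D x) (at x)" "\<And>b. b \<in> Basis \<Longrightarrow> C_k k (\<lambda>x. D x b)"
    using C_k_SucE[OF Suc.prems(1)] by metis
  obtain E where E: "\<And>x. (h has_derivative E x) (at x)" "\<And>b. b \<in> Basis \<Longrightarrow> C_k k (\<lambda>x. E x b)"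
    using C_k_SucE[OF Suc.prems(2)] by metis
  show ?case
  proof (rule C_k_SucI[of _ "\<lambda>x b. f x * E x b + D x b * h x", OF has_derivative_mult[OF D(1) E(1)]])
    fix b :: 'a assume b: "b \<in> Basis"
    show "C_k k (\<lambda>x. f x * E x b + D x b * h x)"
      using Suc.IH[OF C_k_SucD[OF Suc.prems(1)] E(2)[OF b]] Suc.IH[OF D(2)[OF b] C_k_SucD[OF Suc.prems(2)]]
      by (rule C_k_add)
  qed
qed (simp add: continuous_on_mult)

lemma C_k_cmult: "C_k k f \<Longrightarrow> C_k k (\<lambda>x. c * f x)"
  by (intro C_k_mult C_k_const)

lemma C_k_diff: "C_k k f \<Longrightarrow> C_k k h \<Longrightarrow> C_k k (\<lambda>x. f x - h x)"
  using C_k_add[OF _ C_k_cmult[of k h "-1"], of f] by simp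

text \<open>The derivative of the reciprocal root \<open>?q\<close> is a product of
  \<open>f\<close>, its derivative and three factors \<open>?q\<close>, so the induction closes
  under products without a general chain rule.\<close>

lemma C_k_inverse_sqrt:
  fixes \<epsilon> :: real and f :: "'a::euclidean_space \<Rightarrow> real"
  assumes "0 < \<epsilon>"
  shows "C_k k f \<Longrightarrow> C_k k (\<lambda>x. inverse (sqrt ((f x)\<^sup>2 + \<epsilon>\<^sup>2)))"
proof (induction k)
  case 0
  have "sqrt ((f x)\<^sup>2 + \<epsilon>\<^sup>2) \<noteq> 0" for x using assms by (simp add: add_nonneg_eq_0_iff)
  moreover have "continuous_on UNIV f" using 0 by simp
  ultimately show ?case
    unfolding C_k.simps
    by (intro continuous_on_inverse continuous_on_real_sqrt continuous_on_add continuous_on_power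
        continuous_on_const ballI)
next
  case (Suc k)
  note f = C_k_SucD[OF Suc.prems] Suc.IH[OF C_k_SucD[OF Suc.prems]]
  let ?q = "\<lambda>x. inverse (sqrt ((f x)\<^sup>2 + \<epsilon>\<^sup>2))"
  obtain D where D: "\<And>x. (f has_derivative D x) (at x)" "\<And>b. b \<in> Basis \<Longrightarrow> C_k k (\<lambda>x. D x b)"
    using C_k_SucE[OF Suc.prems(1)] by metis
  have "(?q has_derivative (\<lambda>b. (-1) * (f x * D x b * (?q x * ?q x * ?q x)))) (at x)" for x
  proof -
    have p: "0 < (f x)\<^sup>2 + \<epsilon>\<^sup>2" using assms by (simp add: add_nonneg_pos)
    have "((\<lambda>t. sqrt (t\<^sup>2 + \<epsilon>\<^sup>2)) has_real_derivative (inverse (sqrt ((f x)\<^sup>2 + \<epsilon>\<^sup>2)) / 2) * (2 * f x)) (at (f x))"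
      by (rule DERIV_chain2[where f=sqrt and g="\<lambda>t. t\<^sup>2 + \<epsilon>\<^sup>2", OF DERIV_real_sqrt[OF p]]) (auto intro!: derivative_eq_intros)
    from DERIV_inverse'[OF this]
    have "((\<lambda>t. inverse (sqrt (t\<^sup>2 + \<epsilon>\<^sup>2))) has_real_derivative
        - (?q x * (inverse (sqrt ((f x)\<^sup>2 + \<epsilon>\<^sup>2)) / 2 * (2 * f x)) * ?q x)) (at (f x))"
      using p by (metis less_irrefl real_sqrt_gt_0_iff)
    from DERIV_compose_FDERIV[where f="\<lambda>t. inverse (sqrt (t\<^sup>2 + \<epsilon>\<^sup>2))", OF this D(1)]
    have "(?q has_derivative (\<lambda>b. D x b * (- (?q x * (?q x / 2 * (2 * f x)) * ?q x)))) (at x)" .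
    then show ?thesis by (simp add: mult.assoc mult.left_commute)
  qed
  note der = this
  show ?case
  proof (rule C_k_SucI[of _ "\<lambda>x b. (-1) * (f x * D x b * (?q x * ?q x * ?q x))", OF der])
    fix b :: 'a assume "b \<in> Basis"
    from D(2)[OF this] show "C_k k (\<lambda>x. (-1) * (f x * D x b * (?q x * ?q x * ?q x)))"
      by (intro C_k_mult C_k_const f)
  qed
qed

text \<open>A smooth approximation of \<open>max t 0\<close>. Subtracting \<open>\<epsilon>\<close>
  makes it vanish at 0, which keeps supports compact; the price is slightly negative values for
  negative \<open>t\<close>.\<close>

definition smooth_pos :: "real \<Rightarrow> real \<Rightarrow> real" where
  "smooth_pos \<epsilon> t = (t + sqrt (t\<^sup>2 + \<epsilon>\<^sup>2) - \<epsilon>) / 2"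

lemma smooth_pos_0: "0 < \<epsilon> \<Longrightarrow> smooth_pos \<epsilon> 0 = 0"
  by (simp add: smooth_pos_def)

text \<open>The root is the Euclidean length of the vector with entries \<open>t\<close> and
  \<open>\<epsilon>\<close>, so it varies by at most \<open>\<bar>t - t'\<bar>\<close>; averaging
  with \<open>t\<close> preserves the constant 1.\<close>

lemma smooth_pos_lipschitz: "\<bar>smooth_pos \<epsilon> t - smooth_pos \<epsilon> t'\<bar> \<le> \<bar>t - t'\<bar>"
proof -
  have "\<bar>(t + S - \<epsilon>) / 2 - (t' + S' - \<epsilon>) / 2\<bar> \<le> \<bar>t - t'\<bar>"
    if "S \<le> S' + \<bar>t - t'\<bar>" "S' \<le> S + \<bar>t' - t\<bar>" for S S'
    using that by (auto simp: abs_if field_simps split: if_splits)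
  moreover have "sqrt (a\<^sup>2 + \<epsilon>\<^sup>2) \<le> sqrt (b\<^sup>2 + \<epsilon>\<^sup>2) + \<bar>a - b\<bar>" for a b
    using real_sqrt_sum_squares_triangle_ineq[of b "a - b" \<epsilon> 0] by simp
  ultimately show ?thesis unfolding smooth_pos_def by blast
qed

lemma smooth_pos_approx:
  assumes "0 < \<epsilon>"
  shows "\<bar>smooth_pos \<epsilon> t - max t 0\<bar> \<le> \<epsilon>"
proof -
  have "\<bar>(t + S - \<epsilon>) / 2 - max t 0\<bar> \<le> \<epsilon>" if "\<bar>t\<bar> \<le> S" "S \<le> \<bar>t\<bar> + \<bar>\<epsilon>\<bar>" for S
    using that assms by (auto simp: max_def abs_if field_simps split: if_splits)
  then show ?thesis
    unfolding smooth_pos_def using real_sqrt_ge_abs1 sqrt_sum_squares_le_sum_abs by blast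
qed

lemma C_k_smooth_pos:
  assumes "0 < \<epsilon>" "C_k k f"
  shows "C_k k (\<lambda>x. smooth_pos \<epsilon> (f x))"
proof -
  have p: "0 < (f x)\<^sup>2 + \<epsilon>\<^sup>2" for x using assms by (simp add: add_nonneg_pos)
  \<comment> \<open>Writing the root as \<open>P\<close> times its reciprocal reduces smoothness to
    \<open>C_k_inverse_sqrt\<close>.\<close>
  have "P * inverse (sqrt P) = sqrt P" if "0 < P" for P :: real
    using that real_div_sqrt[of P] by (simp add: divide_inverse)
  from this[OF p]
  have "smooth_pos \<epsilon> (f x) = (1 / 2) * (f x + ((f x * f x + \<epsilon> * \<epsilon>) * inverse (sqrt ((f x)\<^sup>2 + \<epsilon>\<^sup>2)) - \<epsilon>))" for x
    unfolding power2_eq_square[symmetric] by (simp only: smooth_pos_def) simp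
  then show ?thesis
    using assms by (simp only:) (intro C_k_cmult C_k_add C_k_diff C_k_mult C_k_const C_k_inverse_sqrt)
qed

text \<open>As \<open>smooth_pos\<close> vanishes at 0, the new support lies in the union of the two
  old ones.\<close>

lemma smooth_pos_diff_test_functions:
  assumes "0 < \<epsilon>" "\<phi> \<in> test_functions \<Omega>" "\<psi> \<in> test_functions \<Omega>"
  shows "(\<lambda>x. smooth_pos \<epsilon> (\<phi> x - \<psi> x)) \<in> test_functions \<Omega>"
proof -
  let ?\<chi> = "\<lambda>x. smooth_pos \<epsilon> (\<phi> x - \<psi> x)"
  let ?K = "closure {x. \<phi> x \<noteq> 0} \<union> closure {x. \<psi> x \<noteq> 0}"
  have "{x. ?\<chi> x \<noteq> 0} \<subseteq> {x. \<phi> x \<noteq> 0} \<union> {x. \<psi> x \<noteq> 0}"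
    using smooth_pos_0[OF assms(1)] by auto
  then have sub: "closure {x. ?\<chi> x \<noteq> 0} \<subseteq> ?K"
    unfolding closure_Un[symmetric] by (rule closure_mono)
  have "compact ?K" using assms by (auto simp: test_functions_def)
  moreover have "?K \<inter> closure {x. ?\<chi> x \<noteq> 0} = closure {x. ?\<chi> x \<noteq> 0}"
    using sub by (rule Int_absorb1)
  moreover have "compact (?K \<inter> closure {x. ?\<chi> x \<noteq> 0})"
    using \<open>compact ?K\<close> closed_closure by (rule compact_Int_closed)
  ultimately have "compact (closure {x. ?\<chi> x \<noteq> 0})" by (simp only:)
  with sub assms show ?thesis
    by (auto simp: test_functions_def intro!: C_k_smooth_pos C_k_diff)
qed

subsection \<open>Measurability\<close>

lemma AE_lebesgue_pair:
  fixes P :: "'a::euclidean_space \<times> 'b::euclidean_space \<Rightarrow> bool"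
  assumes "AE z in lebesgue. P z"
  shows "AE x in lebesgue. AE y in lebesgue. P (x, y)"
  using assms unfolding AE_completion_iff lborel_prod[symmetric] by (rule lborel_pair.AE_pair)

text \<open>On the product, \<open>lebesgue\<close> is the completion of the Borel product measure.
  The exceptional set is therefore first enlarged to a Borel null set, whose cylinder is null by
  Fubini.\<close>

lemma AE_lebesgue_fst:
  fixes P :: "'a::euclidean_space \<Rightarrow> bool"
  assumes "AE x in lebesgue. P x"
  shows "AE z in (lebesgue :: ('a \<times> 'b::euclidean_space) measure). P (fst z)"
proof -
  have "AE x in lborel. P x" using assms by (simp only: AE_completion_iff)
  then obtain N where N: "N \<in> sets lborel" "emeasure lborel N = 0" "{x. \<not> P x} \<subseteq> N"
    by (auto simp: eventually_ae_filter null_sets_def)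
  have "AE z in (lborel \<Otimes>\<^sub>M lborel :: ('a \<times> 'b) measure). fst z \<notin> N"
  proof (rule lborel_pair.AE_pair_measure)
    show "{z \<in> space (lborel \<Otimes>\<^sub>M lborel). fst z \<notin> N} \<in> sets (lborel \<Otimes>\<^sub>M lborel)"
      using N(1) by measurable
    have "AE x in lborel. x \<notin> N" using N by (intro AE_not_in) (auto simp: null_sets_def)
    then show "AE x in lborel. AE y in lborel. fst (x, y) \<notin> N" by auto
  qed
  then have "AE z in (lborel :: ('a \<times> 'b) measure). P (fst z)"
    unfolding lborel_prod by (rule eventually_mono) (use N(3) in auto)
  then show ?thesis by (simp add: AE_completion_iff)
qed

lemma AE_lebesgue_snd:
  fixes P :: "'a::euclidean_space \<Rightarrow> bool"
  assumes "AE x in lebesgue. P x"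
  shows "AE z in (lebesgue :: ('b::euclidean_space \<times> 'a) measure). P (snd z)"
proof -
  have "AE x in lborel. P x" using assms by (simp only: AE_completion_iff)
  then obtain N where N: "N \<in> sets lborel" "emeasure lborel N = 0" "{x. \<not> P x} \<subseteq> N"
    by (auto simp: eventually_ae_filter null_sets_def)
  have "AE z in (lborel \<Otimes>\<^sub>M lborel :: ('b \<times> 'a) measure). snd z \<notin> N"
  proof (rule lborel_pair.AE_pair_measure)
    show "{z \<in> space (lborel \<Otimes>\<^sub>M lborel). snd z \<notin> N} \<in> sets (lborel \<Otimes>\<^sub>M lborel)"
      using N(1) by measurable
    have "AE x in lborel. x \<notin> N" using N by (intro AE_not_in) (auto simp: null_sets_def)
    then show "AE x in lborel. AE y in lborel. snd (x, y) \<notin> N" by auto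
  qed
  then have "AE z in (lborel :: ('b \<times> 'a) measure). P (snd z)"
    unfolding lborel_prod by (rule eventually_mono) (use N(3) in auto)
  then show ?thesis by (simp add: AE_completion_iff)
qed

text \<open>A Borel representative of \<open>u\<close> can be composed with the continuous
  projection; returning to \<open>u\<close> changes values only on a cylinder over a null
  set.\<close>

lemma borel_measurable_lebesgue_fst:
  fixes u :: "'a::euclidean_space \<Rightarrow> real"
  assumes "u \<in> borel_measurable lebesgue"
  shows "(\<lambda>z. u (fst z)) \<in> borel_measurable (lebesgue :: ('a \<times> 'b::euclidean_space) measure)"
proof -
  obtain u' where u': "u' \<in> borel_measurable borel" "AE x in lebesgue. u x = u' x"
    using completion_ex_borel_measurable_real[OF assms] by (auto simp: AE_completion_iff)
  have "(\<lambda>z. u' (fst z)) \<in> borel_measurable (lebesgue :: ('a \<times> 'b) measure)"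
    using measurable_compose[of fst borel borel u' borel, OF borel_measurable_continuous_onI u'(1)]
    by (intro measurable_completion) (simp add: continuous_on_fst)
  then show ?thesis
    by (rule borel_measurable_AE) (use AE_lebesgue_fst[OF u'(2)] in \<open>auto elim!: eventually_mono\<close>)
qed

lemma borel_measurable_lebesgue_snd:
  fixes u :: "'a::euclidean_space \<Rightarrow> real"
  assumes "u \<in> borel_measurable lebesgue"
  shows "(\<lambda>z. u (snd z)) \<in> borel_measurable (lebesgue :: ('b::euclidean_space \<times> 'a) measure)"
proof -
  obtain u' where u': "u' \<in> borel_measurable borel" "AE x in lebesgue. u x = u' x"
    using completion_ex_borel_measurable_real[OF assms] by (auto simp: AE_completion_iff)
  have "(\<lambda>z. u' (snd z)) \<in> borel_measurable (lebesgue :: ('b \<times> 'a) measure)"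
    using measurable_compose[of snd borel borel u' borel, OF borel_measurable_continuous_onI u'(1)]
    by (intro measurable_completion) (simp add: continuous_on_snd)
  then show ?thesis
    by (rule borel_measurable_AE) (use AE_lebesgue_snd[OF u'(2)] in \<open>auto elim!: eventually_mono\<close>)
qed

lemma borel_measurable_frac_diff:
  fixes u :: "'a::euclidean_space \<Rightarrow> real"
  assumes "u \<in> borel_measurable lebesgue"
  shows "(\<lambda>z. frac_diff s u (fst z) (snd z)) \<in> borel_measurable lebesgue"
proof -
  have "(\<lambda>z::'a \<times> 'a. norm (fst z - snd z)) \<in> borel_measurable lebesgue"
    by (intro measurable_completion) (simp add: borel_measurable_continuous_onI continuous_intros)
  then show ?thesis
    unfolding frac_diff_def
    using borel_measurable_lebesgue_fst[OF assms] borel_measurable_lebesgue_snd[OF assms]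
    by measurable
qed

section \<open>Kernels that are measurable in the point and continuous in \<open>r\<close>\<close>

lemma Caratheodory_measurable:
  fixes h :: "'z \<Rightarrow> real \<Rightarrow> real" and f :: "'z \<Rightarrow> real"
  assumes h: "\<And>r. 0 < r \<Longrightarrow> (\<lambda>z. h z r) \<in> borel_measurable M"
    and cont: "\<And>z. continuous_on {0<..} (h z)"
    and f[measurable]: "f \<in> borel_measurable M"
  shows "(\<lambda>z. f z * h z \<bar>f z\<bar>) \<in> borel_measurable M"
proof -
  \<comment> \<open>At zeros of \<open>f\<close> the kernel would be evaluated at 0, where nothing
    is assumed. The value 1 is a dummy there, cancelled by the factor \<open>f z\<close>.\<close>
  define p where "p z = (if f z = 0 then 1 else \<bar>f z\<bar>)" for z
  have [measurable]: "p \<in> borel_measurable M" unfolding p_def by measurable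
  have p: "0 < p z" for z by (simp add: p_def)
  \<comment> \<open>The grid point \<open>q n (k n z)\<close> lies at or above \<open>p z\<close>,
    within \<open>1 / (n + 1)\<close>; the summand 1 in \<open>q\<close> keeps it positive. For
    fixed \<open>n\<close> it takes countably many values, so evaluating \<open>h\<close> there is
    measurable.\<close>
  define k where "k n z = nat \<lfloor>p z * real (Suc n)\<rfloor>" for n z
  define q where "q n m = (real m + 1) / real (Suc n)" for n m
  have "(\<lambda>z. h z (q n (k n z))) \<in> borel_measurable M" for n
  proof (rule measurable_compose_countable[where f="\<lambda>m z. h z (q n m)" and g="k n"])
    show "(\<lambda>z. h z (q n m)) \<in> borel_measurable M" for m by (rule h) (simp add: q_def)
    show "k n \<in> M \<rightarrow>\<^sub>M count_space UNIV" unfolding k_def by measurable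
  qed
  moreover have "(\<lambda>n. h z (q n (k n z))) \<longlonglongrightarrow> h z (p z)" for z
  proof -
    have bnd: "p z \<le> q n (k n z) \<and> q n (k n z) \<le> p z + 1 / real (Suc n)" for n
    proof -
      have nn: "0 \<le> p z * real (Suc n)" using p[of z] by simp
      have "real (k n z) = of_int \<lfloor>p z * real (Suc n)\<rfloor>" using nn by (simp add: k_def)
      then have "p z * real (Suc n) \<le> real (k n z) + 1" "real (k n z) \<le> p z * real (Suc n)"
        using floor_correct[of "p z * real (Suc n)"] by linarith+
      then show ?thesis by (simp add: q_def field_simps del: of_nat_Suc)
    qed
    have "(\<lambda>n. q n (k n z)) \<longlonglongrightarrow> p z"
    proof (rule tendsto_sandwich[of "\<lambda>_. p z" _ _ "\<lambda>n. p z + 1 / real (Suc n)"])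
      show "(\<lambda>n. p z + 1 / real (Suc n)) \<longlonglongrightarrow> p z"
        using tendsto_add[OF tendsto_const LIMSEQ_inverse_real_of_nat, of "p z"] by (simp add: inverse_eq_divide)
    qed (use bnd in auto)
    moreover have "isCont (h z) (p z)"
      using cont[of z] p[of z] by (simp add: continuous_on_eq_continuous_at)
    ultimately show ?thesis by (rule isCont_tendsto_compose[rotated])
  qed
  ultimately have [measurable]: "(\<lambda>z. h z (p z)) \<in> borel_measurable M"
    by (rule borel_measurable_LIMSEQ_real[rotated])
  have "(\<lambda>z. f z * h z \<bar>f z\<bar>) = (\<lambda>z. f z * h z (p z))" by (auto simp: p_def)
  then show ?thesis by simp
qed

text \<open>The linear isomorphism \<open>S\<close> with inverse \<open>T\<close> only reorders the factors of a product, so that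
  the sliced variable comes first.\<close>

lemma AE_measurable_slices:
  fixes f :: "'c::euclidean_space \<Rightarrow> real" and S :: "'d::euclidean_space \<times> 'e::euclidean_space \<Rightarrow> 'c"
  assumes f: "f \<in> borel_measurable lebesgue"
    and S: "linear S" and T: "linear T" "\<And>p. T (S p) = p" and dim: "DIM('c) \<le> DIM('d \<times> 'e)"
  shows "AE d in lebesgue. (\<lambda>e. f (S (d, e))) \<in> borel_measurable lebesgue"
proof -
  obtain f' where f': "f' \<in> borel_measurable borel" "AE x in lebesgue. f x = f' x"
    using completion_ex_borel_measurable_real[OF f] by (auto simp: AE_completion_iff)
  then obtain N where N: "negligible N" "{x. f x \<noteq> f' x} \<subseteq> N"
    by (auto simp: eventually_ae_filter_negligible)
  \<comment> \<open>A linear map into a space of at least the same dimension sends null sets to null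
    sets; this is the use of \<open>dim\<close>.\<close>
  have "negligible (T ` N)"
    by (rule negligible_differentiable_image_negligible[OF dim N(1) linear_imp_differentiable_on[OF T(1)]])
  moreover have "{p. f (S p) \<noteq> f' (S p)} \<subseteq> T ` N"
  proof
    fix p assume "p \<in> {p. f (S p) \<noteq> f' (S p)}"
    then have "S p \<in> N" using N(2) by auto
    then show "p \<in> T ` N" using T(2)[of p] by (metis imageI)
  qed
  ultimately have "AE p in lebesgue. f' (S p) = f (S p)"
    unfolding eventually_ae_filter_negligible by (metis (mono_tags, lifting) Collect_cong)
  from AE_lebesgue_pair[OF this] show ?thesis
  proof eventually_elim
    case (elim d)
    have "continuous_on UNIV (\<lambda>e. (d, e))"
      by (intro continuous_on_Pair continuous_on_const continuous_on_id)
    from linear_continuous_on_compose[OF this S]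
    have "continuous_on UNIV (\<lambda>e. S (d, e))" by simp
    then have "(\<lambda>e. f' (S (d, e))) \<in> borel_measurable lebesgue"
      using measurable_compose[OF borel_measurable_continuous_onI f'(1), of "\<lambda>e. S (d, e)"]
      by (intro measurable_completion) simp
    then show ?case using elim by (rule borel_measurable_AE)
  qed
qed

text \<open>Fubini gives measurable slices only for almost every \<open>r\<close>. Such parameters
  accumulate from the right at every \<open>r > 0\<close>, and continuity carries measurability to
  the limit.\<close>

lemma measurable_slices_if_continuous:
  fixes h :: "'b::euclidean_space \<Rightarrow> real \<Rightarrow> real"
  assumes ae: "AE r in lebesgue. 0 < r \<longrightarrow> (\<lambda>z. h z r) \<in> borel_measurable lebesgue"
    and cont: "\<And>z. continuous_on {0<..} (h z)" and r: "0 < r"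
  shows "(\<lambda>z. h z r) \<in> borel_measurable lebesgue"
proof -
  have "\<exists>t. r < t \<and> t < r + 1 / real (Suc n) \<and> (\<lambda>z. h z t) \<in> borel_measurable lebesgue" for n
  proof (rule ccontr)
    assume "\<not> ?thesis"
    then have "AE t in lebesgue. t \<notin> {r<..<r + 1 / real (Suc n)}"
      using ae r by (auto elim!: eventually_mono)
    then have "{t \<in> space lebesgue. \<not> t \<notin> {r<..<r + 1 / real (Suc n)}} \<in> null_sets lebesgue"
      by (simp only: completion.AE_iff_null_sets)
    then have "negligible {r<..<r + 1 / real (Suc n)}"
      by (simp add: negligible_iff_null_sets greaterThanLessThan_def greaterThan_def lessThan_def Collect_conj_eq)
    then show False
      using negligible_imp_measure0[of "{r<..<r + 1 / real (Suc n)}"] by simp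
  qed
  then obtain t where t: "\<And>n. r < t n" "\<And>n. t n < r + 1 / real (Suc n)"
    "\<And>n. (\<lambda>z. h z (t n)) \<in> borel_measurable lebesgue"
    by metis
  have "t \<longlonglongrightarrow> r"
  proof (rule tendsto_sandwich[of "\<lambda>_. r" _ _ "\<lambda>n. r + 1 / real (Suc n)"])
    show "(\<lambda>n. r + 1 / real (Suc n)) \<longlonglongrightarrow> r"
      using tendsto_add[OF tendsto_const LIMSEQ_inverse_real_of_nat, of r] by (simp add: inverse_eq_divide)
  qed (use t in \<open>auto intro!: always_eventually less_imp_le\<close>)
  moreover have "isCont (h z) r" for z
    using cont[of z] r by (simp add: continuous_on_eq_continuous_at)
  ultimately have "(\<lambda>n. h z (t n)) \<longlonglongrightarrow> h z r" for z
    by (rule isCont_tendsto_compose[rotated])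
  then show ?thesis using t(3) by (rule borel_measurable_LIMSEQ_real)
qed

subsection \<open>Modulars and Luxemburg norms\<close>

locale musielak_kernel =
  fixes gl gu :: real and h :: "'b::euclidean_space \<Rightarrow> real \<Rightarrow> real" and w :: "'b \<Rightarrow> real"
  assumes gl: "0 < gl" and gu: "gl \<le> gu"
    and pos: "\<And>z r. 0 < r \<Longrightarrow> 0 < h z r"
    and lip: "\<And>z a b. 0 < a \<Longrightarrow> a < b \<Longrightarrow> \<exists>L. L-lipschitz_on {a..b} (h z)"
    and meas: "\<And>r. 0 < r \<Longrightarrow> (\<lambda>z. h z r) \<in> borel_measurable lebesgue"
    and growth: "AE z in lebesgue. growth_conditions gl gu (h z)"
    and w_meas[measurable]: "w \<in> borel_measurable lebesgue"
    and w_nonneg: "\<And>z. 0 \<le> w z"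
    and w_pos: "AE z in lebesgue. 0 < w z"
begin

text \<open>Modular and Luxemburg norm for a kernel that depends on a point \<open>z\<close>. The modular of functions is
  the case \<open>z = x\<close>, \<open>w = 1\<close>, that of the fractional differences the case \<open>z = (x, y)\<close> with
  \<open>w\<close> the inverse power of the distance.\<close>

definition Mod :: "('b \<Rightarrow> real) \<Rightarrow> ennreal" where
  "Mod f = (\<integral>\<^sup>+ z. ennreal (flux_primitive (h z) \<bar>f z\<bar> * w z) \<partial>lebesgue)"

definition lux :: "('b \<Rightarrow> real) \<Rightarrow> real" where
  "lux f = Inf {l. l > 0 \<and> Mod (\<lambda>z. f z / l) \<le> 1}"

lemma growth_kernel: "AE z in lebesgue. growth_kernel gl gu (h z)"
  using growth by eventually_elim (simp add: growth_kernel_def gl gu pos lip)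

lemma continuous_on_kernel: "continuous_on {0<..} (h z)"
  using lip by (rule locally_lipschitz_continuous_on)

lemma flux_measurable:
  "f \<in> borel_measurable lebesgue \<Longrightarrow> (\<lambda>z. f z * h z \<bar>f z\<bar>) \<in> borel_measurable lebesgue"
  by (rule Caratheodory_measurable[OF meas continuous_on_kernel])

lemma flux_primitive_measurable:
  assumes f[measurable]: "f \<in> borel_measurable lebesgue"
  shows "(\<lambda>z. flux_primitive (h z) \<bar>f z\<bar>) \<in> borel_measurable lebesgue"
proof -
  \<comment> \<open>As a nonnegative integral with parameter, \<open>I\<close> is measurable by
    Tonelli. The absolute value of \<open>\<rho>\<close> fits the form of
    \<open>Caratheodory_measurable\<close> and changes nothing on the range of integration.\<close>
  define I where "I z = (\<integral>\<^sup>+ \<rho>. ennreal (\<rho> * h z \<bar>\<rho>\<bar>) * indicator {0..\<bar>f z\<bar>} \<rho> \<partial>lborel)" for z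
  have "(\<lambda>p. snd p * h (fst p) \<bar>snd p\<bar>) \<in> borel_measurable (lebesgue \<Otimes>\<^sub>M lborel)"
  proof (rule Caratheodory_measurable[OF _ continuous_on_kernel])
    show "(\<lambda>p. h (fst p) r) \<in> borel_measurable (lebesgue \<Otimes>\<^sub>M lborel)" if "0 < r" for r
      using measurable_compose[OF measurable_fst meas[OF that]] .
  qed simp
  then have [measurable]: "(\<lambda>(z, \<rho>). \<rho> * h z \<bar>\<rho>\<bar>) \<in> borel_measurable (lebesgue \<Otimes>\<^sub>M lborel)"
    by (simp add: case_prod_beta')
  have "(\<lambda>(z, \<rho>). ennreal (\<rho> * h z \<bar>\<rho>\<bar>) * indicator {0..\<bar>f z\<bar>} \<rho>)
      \<in> borel_measurable (lebesgue \<Otimes>\<^sub>M lborel)"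
    unfolding indicator_def atLeastAtMost_iff by measurable
  then have "I \<in> borel_measurable lebesgue"
    unfolding I_def by (rule lborel.borel_measurable_nn_integral)
  then have "(\<lambda>z. enn2real (I z)) \<in> borel_measurable lebesgue" by measurable
  moreover have "AE z in lebesgue. enn2real (I z) = flux_primitive (h z) \<bar>f z\<bar>"
    using growth_kernel
  proof eventually_elim
    case (elim z)
    interpret growth_kernel gl gu "h z" by fact
    have "I z = (\<integral>\<^sup>+ \<rho>. ennreal (\<rho> * h z \<rho>) * indicator {0..\<bar>f z\<bar>} \<rho> \<partial>lborel)"
      unfolding I_def by (intro nn_integral_cong) (auto split: split_indicator)
    also have "\<dots> = ennreal (flux_primitive (h z) \<bar>f z\<bar>)"
    proof (rule nn_integral_has_integral_lebesgue')
      show "((\<lambda>\<rho>. \<rho> * h z \<rho>) has_integral flux_primitive (h z) \<bar>f z\<bar>) {0..\<bar>f z\<bar>}"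
        unfolding flux_primitive_def using flux_integrable by (rule integrable_integral)
    qed (use flux_nonneg in auto)
    finally show ?case using H_nonneg by simp
  qed
  ultimately show ?thesis by (rule borel_measurable_AE)
qed

lemma integrand_measurable:
  assumes [measurable]: "f \<in> borel_measurable lebesgue"
  shows "(\<lambda>z. ennreal (flux_primitive (h z) \<bar>f z\<bar> * w z)) \<in> borel_measurable lebesgue"
  using flux_primitive_measurable[OF assms] by measurable

lemma Mod_mono:
  assumes "AE z in lebesgue. \<bar>f z\<bar> \<le> \<bar>k z\<bar>"
  shows "Mod f \<le> Mod k"
  unfolding Mod_def
proof (rule nn_integral_mono_AE)
  show "AE z in lebesgue. ennreal (flux_primitive (h z) \<bar>f z\<bar> * w z) \<le> ennreal (flux_primitive (h z) \<bar>k z\<bar> * w z)"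
    using assms growth_kernel
  proof eventually_elim
    case (elim z)
    then show ?case
      by (intro ennreal_leI mult_right_mono w_nonneg growth_kernel.H_mono) auto
  qed
qed

text \<open>The factor by which doubling the argument can enlarge the primitive:
  \<open>H_scale_upper\<close> with \<open>c = 2\<close>.\<close>

abbreviation dbl :: real where "dbl \<equiv> 2 powr (gu + 1)"

lemma integrand_add_le:
  assumes "growth_kernel gl gu (h z)" "\<bar>t\<bar> \<le> \<bar>a\<bar> + \<bar>b\<bar>"
  shows "ennreal (flux_primitive (h z) \<bar>t\<bar> * w z) \<le>
    ennreal dbl * (ennreal (flux_primitive (h z) \<bar>a\<bar> * w z) + ennreal (flux_primitive (h z) \<bar>b\<bar> * w z))"
proof -
  interpret growth_kernel gl gu "h z" by fact
  have "flux_primitive (h z) \<bar>t\<bar> * w z \<le> dbl * (flux_primitive (h z) \<bar>a\<bar> + flux_primitive (h z) \<bar>b\<bar>) * w z"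
    using assms w_nonneg by (intro mult_right_mono H_add_le) auto
  also have "\<dots> = dbl * (flux_primitive (h z) \<bar>a\<bar> * w z + flux_primitive (h z) \<bar>b\<bar> * w z)"
    by (simp add: algebra_simps)
  finally have "ennreal (flux_primitive (h z) \<bar>t\<bar> * w z) \<le>
      ennreal (dbl * (flux_primitive (h z) \<bar>a\<bar> * w z + flux_primitive (h z) \<bar>b\<bar> * w z))"
    by (rule ennreal_leI)
  also have "\<dots> = ennreal dbl * (ennreal (flux_primitive (h z) \<bar>a\<bar> * w z) + ennreal (flux_primitive (h z) \<bar>b\<bar> * w z))"
    using H_nonneg w_nonneg[of z] by (simp add: ennreal_mult)
  finally show ?thesis .
qed

lemma Mod_add_le:
  assumes [measurable]: "a \<in> borel_measurable lebesgue" "b \<in> borel_measurable lebesgue"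
    and le: "AE z in lebesgue. \<bar>f z\<bar> \<le> \<bar>a z\<bar> + \<bar>b z\<bar>"
  shows "Mod f \<le> ennreal dbl * (Mod a + Mod b)"
proof -
  note [measurable] = integrand_measurable[OF assms(1)] integrand_measurable[OF assms(2)]
  have "Mod f \<le> (\<integral>\<^sup>+ z. ennreal dbl * (ennreal (flux_primitive (h z) \<bar>a z\<bar> * w z) +
      ennreal (flux_primitive (h z) \<bar>b z\<bar> * w z)) \<partial>lebesgue)"
    unfolding Mod_def
  proof (rule nn_integral_mono_AE)
    show "AE z in lebesgue. ennreal (flux_primitive (h z) \<bar>f z\<bar> * w z) \<le>
        ennreal dbl * (ennreal (flux_primitive (h z) \<bar>a z\<bar> * w z) + ennreal (flux_primitive (h z) \<bar>b z\<bar> * w z))"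
      using growth_kernel le by eventually_elim (rule integrand_add_le)
  qed
  also have "\<dots> = ennreal dbl * (Mod a + Mod b)"
    unfolding Mod_def
    by (simp add: nn_integral_cmult nn_integral_add)
  finally show ?thesis .
qed

lemma Mod_diff_finite:
  assumes "a \<in> borel_measurable lebesgue" "b \<in> borel_measurable lebesgue" "Mod a < \<infinity>" "Mod b < \<infinity>"
  shows "Mod (\<lambda>z. a z - b z) < \<infinity>"
proof -
  have "Mod (\<lambda>z. a z - b z) \<le> ennreal dbl * (Mod a + Mod b)"
    using assms by (intro Mod_add_le) (auto intro: abs_triangle_ineq4)
  also have "\<dots> < \<infinity>" using assms by (simp add: ennreal_mult_less_top)
  finally show ?thesis .
qed

lemma Mod_scale_lower:
  assumes "1 \<le> c" and [measurable]: "f \<in> borel_measurable lebesgue"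
  shows "ennreal c * Mod f \<le> Mod (\<lambda>z. c * f z)"
proof -
  have "ennreal c * Mod f = (\<integral>\<^sup>+ z. ennreal c * ennreal (flux_primitive (h z) \<bar>f z\<bar> * w z) \<partial>lebesgue)"
    unfolding Mod_def by (simp add: nn_integral_cmult integrand_measurable)
  also have "\<dots> \<le> Mod (\<lambda>z. c * f z)"
    unfolding Mod_def
  proof (rule nn_integral_mono_AE)
    show "AE z in lebesgue. ennreal c * ennreal (flux_primitive (h z) \<bar>f z\<bar> * w z)
        \<le> ennreal (flux_primitive (h z) \<bar>c * f z\<bar> * w z)"
      using growth_kernel
    proof eventually_elim
      case (elim z)
      then interpret growth_kernel gl gu "h z" .
      have "c * flux_primitive (h z) \<bar>f z\<bar> * w z \<le> flux_primitive (h z) (c * \<bar>f z\<bar>) * w z"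
        using assms w_nonneg by (intro mult_right_mono H_scale_lower) auto
      then show ?case
        using assms H_nonneg w_nonneg[of z]
        by (simp add: abs_mult ennreal_leI mult.assoc flip: ennreal_mult)
    qed
  qed
  finally show ?thesis .
qed

lemma Mod_scale_upper:
  assumes "1 \<le> c" and [measurable]: "f \<in> borel_measurable lebesgue"
  shows "Mod (\<lambda>z. c * f z) \<le> ennreal (c powr (gu + 1)) * Mod f"
proof -
  have "Mod (\<lambda>z. c * f z) \<le>
      (\<integral>\<^sup>+ z. ennreal (c powr (gu + 1)) * ennreal (flux_primitive (h z) \<bar>f z\<bar> * w z) \<partial>lebesgue)"
    unfolding Mod_def
  proof (rule nn_integral_mono_AE)
    show "AE z in lebesgue. ennreal (flux_primitive (h z) \<bar>c * f z\<bar> * w z)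
        \<le> ennreal (c powr (gu + 1)) * ennreal (flux_primitive (h z) \<bar>f z\<bar> * w z)"
      using growth_kernel
    proof eventually_elim
      case (elim z)
      then interpret growth_kernel gl gu "h z" .
      have "flux_primitive (h z) (c * \<bar>f z\<bar>) * w z \<le> c powr (gu + 1) * flux_primitive (h z) \<bar>f z\<bar> * w z"
        using assms w_nonneg by (intro mult_right_mono H_scale_upper) auto
      then show ?case
        using assms H_nonneg w_nonneg[of z]
        by (simp add: abs_mult ennreal_leI mult.assoc flip: ennreal_mult)
    qed
  qed
  also have "\<dots> = ennreal (c powr (gu + 1)) * Mod f"
    unfolding Mod_def by (simp add: nn_integral_cmult integrand_measurable)
  finally show ?thesis .
qed

section \<open>Luxemburg norm against modular\<close>

lemma lux_set_nonempty:
  assumes f: "f \<in> borel_measurable lebesgue" and fin: "Mod f < \<infinity>"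
  shows "{l. l > 0 \<and> Mod (\<lambda>z. f z / l) \<le> 1} \<noteq> {}"
proof -
  \<comment> \<open>Division by \<open>l \<ge> 1\<close> divides the modular by at least
    \<open>l\<close>, so its own value, raised to 1 if smaller, is a suitable
    \<open>l\<close>.\<close>
  define l where "l = max 1 (enn2real (Mod f))"
  have l: "1 \<le> l" by (simp add: l_def)
  have "ennreal l * Mod (\<lambda>z. f z / l) \<le> Mod (\<lambda>z. l * (f z / l))"
    using l f by (intro Mod_scale_lower) auto
  also have "\<dots> = Mod f" using l by simp
  also have "\<dots> = ennreal (enn2real (Mod f))" using fin by (simp add: less_top)
  also have "\<dots> \<le> ennreal l * 1" by (simp add: l_def ennreal_leI)
  finally have "Mod (\<lambda>z. f z / l) \<le> 1"
    using l by (subst (asm) ennreal_mult_le_mult_iff) auto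
  then show ?thesis using l by (auto intro!: exI[of _ l])
qed

lemma lux_nonneg:
  assumes "f \<in> borel_measurable lebesgue" "Mod f < \<infinity>"
  shows "0 \<le> lux f"
  unfolding lux_def using lux_set_nonempty[OF assms] by (rule cInf_greatest) auto

text \<open>Some \<open>l < e \<le> 1\<close> is admissible in the infimum, and superlinear scaling
  by \<open>1 / l\<close> bounds the modular by \<open>l\<close>.\<close>

lemma Mod_le_if_lux_less:
  assumes f: "f \<in> borel_measurable lebesgue" and fin: "Mod f < \<infinity>" and e: "lux f < e" "e \<le> 1"
  shows "Mod f \<le> ennreal e"
proof -
  obtain l where l: "0 < l" "l < e" "Mod (\<lambda>z. f z / l) \<le> 1"
    using cInf_lessD[OF lux_set_nonempty[OF f fin] e(1)[unfolded lux_def]] by auto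
  have "ennreal (1 / l) * Mod f \<le> Mod (\<lambda>z. 1 / l * f z)"
    using l e f by (intro Mod_scale_lower) auto
  with l(3) have "ennreal (1 / l) * Mod f \<le> 1" by simp
  then have "ennreal l * (ennreal (1 / l) * Mod f) \<le> ennreal l * 1" by (rule mult_left_mono) simp
  then have "Mod f \<le> ennreal l"
    using l(1) by (simp add: mult.assoc[symmetric] flip: ennreal_mult)
  also have "\<dots> \<le> ennreal e" using l by (simp add: ennreal_leI)
  finally show ?thesis .
qed

text \<open>Here the upper growth bound turns small modulars into small norms: scaling by
  \<open>1 / e\<close> costs exactly the inverse of \<open>e powr (gu + 1)\<close>.\<close>

lemma lux_le_if_Mod_le:
  assumes f: "f \<in> borel_measurable lebesgue" and e: "0 < e" "e \<le> 1"
    and le: "Mod f \<le> ennreal (e powr (gu + 1))"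
  shows "lux f \<le> e"
  unfolding lux_def
proof (rule cInf_lower)
  have "Mod (\<lambda>z. f z / e) \<le> ennreal ((1 / e) powr (gu + 1)) * Mod f"
    using Mod_scale_upper[of "1 / e" f] e f by simp
  also have "\<dots> \<le> ennreal ((1 / e) powr (gu + 1)) * ennreal (e powr (gu + 1))"
    using le by (rule mult_left_mono) simp
  also have "\<dots> = 1" using e by (simp add: powr_divide flip: ennreal_mult)
  finally show "e \<in> {l. l > 0 \<and> Mod (\<lambda>z. f z / l) \<le> 1}" using e by simp
qed (auto intro: bdd_belowI[of _ 0])

section \<open>Convergence in modular and integrability of the weak form\<close>

lemma Mod_tendsto_0_dominated:
  assumes meas: "\<And>n. f n \<in> borel_measurable lebesgue" "\<And>n. e n \<in> borel_measurable lebesgue"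
      "b \<in> borel_measurable lebesgue"
    and le: "\<And>n. AE z in lebesgue. \<bar>f n z\<bar> \<le> \<bar>e n z\<bar> + \<bar>b z\<bar>"
    and fin: "(\<Sum>n. Mod (e n)) < \<infinity>" "Mod b < \<infinity>"
    and lim: "AE z in lebesgue. (\<lambda>n. f n z) \<longlonglongrightarrow> 0"
  shows "(\<lambda>n. Mod (f n)) \<longlonglongrightarrow> 0"
proof -
  note [measurable] = meas integrand_measurable[OF meas(1)] integrand_measurable[OF meas(2)]
    integrand_measurable[OF meas(3)]
  \<comment> \<open>A majorant must serve all \<open>n\<close> at once. The sum of the integrands of
    all errors does, and its integral is finite by the summability hypothesis.\<close>
  define W where "W z = ennreal dbl * ((\<Sum>n. ennreal (flux_primitive (h z) \<bar>e n z\<bar> * w z)) +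
      ennreal (flux_primitive (h z) \<bar>b z\<bar> * w z))" for z
  have "(\<lambda>n. \<integral>\<^sup>+ z. ennreal (flux_primitive (h z) \<bar>f n z\<bar> * w z) \<partial>lebesgue) \<longlonglongrightarrow> (\<integral>\<^sup>+ z. 0 \<partial>(lebesgue :: 'b measure))"
  proof (rule nn_integral_dominated_convergence[where w=W])
    show "(\<integral>\<^sup>+ z. W z \<partial>lebesgue) < \<infinity>"
      using fin unfolding W_def Mod_def
      by (simp add: nn_integral_cmult nn_integral_add nn_integral_suminf ennreal_mult_less_top)
    show "W \<in> borel_measurable lebesgue" unfolding W_def by measurable
    show "AE z in lebesgue. ennreal (flux_primitive (h z) \<bar>f n z\<bar> * w z) \<le> W z" for n
      using growth_kernel le[of n]
    proof eventually_elim
      case (elim z)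
      have "ennreal (flux_primitive (h z) \<bar>e n z\<bar> * w z) \<le> (\<Sum>n. ennreal (flux_primitive (h z) \<bar>e n z\<bar> * w z))"
        using sum_le_suminf[of "\<lambda>n. ennreal (flux_primitive (h z) \<bar>e n z\<bar> * w z)" "{n}"] by simp
      then have "ennreal dbl * (ennreal (flux_primitive (h z) \<bar>e n z\<bar> * w z) + ennreal (flux_primitive (h z) \<bar>b z\<bar> * w z)) \<le> W z"
        unfolding W_def by (intro mult_left_mono add_right_mono) auto
      with integrand_add_le[OF elim] show ?case by (rule order_trans)
    qed
    show "AE z in lebesgue. (\<lambda>n. ennreal (flux_primitive (h z) \<bar>f n z\<bar> * w z)) \<longlonglongrightarrow> 0"
      using growth_kernel lim
    proof eventually_elim
      case (elim z)
      interpret growth_kernel gl gu "h z" by fact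
      have "(\<lambda>n. flux_primitive (h z) \<bar>f n z\<bar> * w z) \<longlonglongrightarrow> 0"
        using elim(2) by (intro tendsto_mult_left_zero H_tendsto_0 tendsto_rabs_zero) auto
      then show ?case using tendsto_ennrealI by fastforce
    qed
  qed simp_all
  then show ?thesis by (simp add: Mod_def)
qed

text \<open>The summed integrands have finite integral, hence form a convergent series almost
  everywhere. The whole sequence converges, without passing to a subsequence.\<close>

lemma AE_tendsto_0_if_summable_Mod:
  assumes meas: "\<And>n. e n \<in> borel_measurable lebesgue" and fin: "(\<Sum>n. Mod (e n)) < \<infinity>"
  shows "AE z in lebesgue. (\<lambda>n. e n z) \<longlonglongrightarrow> 0"
proof -
  note [measurable] = integrand_measurable[OF meas]
  have "(\<integral>\<^sup>+ z. (\<Sum>n. ennreal (flux_primitive (h z) \<bar>e n z\<bar> * w z)) \<partial>lebesgue) \<noteq> \<infinity>"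
    using fin unfolding Mod_def by (simp add: nn_integral_suminf less_top)
  then have "AE z in lebesgue. (\<Sum>n. ennreal (flux_primitive (h z) \<bar>e n z\<bar> * w z)) \<noteq> \<infinity>"
    by (intro nn_integral_PInf_AE) auto
  then show ?thesis
    using growth_kernel w_pos
  proof eventually_elim
    case (elim z)
    interpret growth_kernel gl gu "h z" by fact
    have "summable (\<lambda>n. flux_primitive (h z) \<bar>e n z\<bar> * w z)"
      using elim(1) H_nonneg w_nonneg[of z] by (intro summable_suminf_not_top) auto
    then have "(\<lambda>n. flux_primitive (h z) \<bar>e n z\<bar> * w z) \<longlonglongrightarrow> 0" by (rule summable_LIMSEQ_zero)
    from tendsto_divide[OF this tendsto_const[of "w z"]] have "(\<lambda>n. flux_primitive (h z) \<bar>e n z\<bar>) \<longlonglongrightarrow> 0"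
      using elim(3) by simp
    then have "(\<lambda>n. \<bar>e n z\<bar>) \<longlonglongrightarrow> 0" by (rule tendsto_0_if_H_tendsto_0) simp
    then show ?case by (rule tendsto_rabs_zero_cancel)
  qed
qed

text \<open>Without integrability the Bochner integral takes the default value 0, and the weak forms
  of two functions could not be subtracted under one integral.\<close>

lemma integrable_flux_mult:
  assumes meas[measurable]: "f \<in> borel_measurable lebesgue" "k \<in> borel_measurable lebesgue"
    and fin: "Mod f < \<infinity>" "Mod k < \<infinity>"
  shows "integrable lebesgue (\<lambda>z. f z * h z \<bar>f z\<bar> * k z * w z)"
proof (rule integrableI_bounded)
  note [measurable] = flux_measurable[OF meas(1)] integrand_measurable[OF meas(1)]
    integrand_measurable[OF meas(2)]
  show "(\<lambda>z. f z * h z \<bar>f z\<bar> * k z * w z) \<in> borel_measurable lebesgue" by measurable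
  have "(\<integral>\<^sup>+ z. ennreal (norm (f z * h z \<bar>f z\<bar> * k z * w z)) \<partial>lebesgue) \<le>
    (\<integral>\<^sup>+ z. ennreal dbl * (ennreal (flux_primitive (h z) \<bar>f z\<bar> * w z) +
      ennreal (flux_primitive (h z) \<bar>k z\<bar> * w z)) \<partial>lebesgue)"
  proof (rule nn_integral_mono_AE)
    show "AE z in lebesgue. ennreal (norm (f z * h z \<bar>f z\<bar> * k z * w z)) \<le>
        ennreal dbl * (ennreal (flux_primitive (h z) \<bar>f z\<bar> * w z) + ennreal (flux_primitive (h z) \<bar>k z\<bar> * w z))"
      using growth_kernel
    proof eventually_elim
      case (elim z)
      then interpret growth_kernel gl gu "h z" .
      have "norm (f z * h z \<bar>f z\<bar> * k z * w z) = (\<bar>f z\<bar> * h z \<bar>f z\<bar>) * \<bar>k z\<bar> * w z"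
        using w_nonneg[of z] pos[of "\<bar>f z\<bar>"] by (cases "f z = 0") (auto simp: abs_mult)
      also have "\<dots> \<le> dbl * (flux_primitive (h z) \<bar>f z\<bar> + flux_primitive (h z) \<bar>k z\<bar>) * w z"
        using w_nonneg by (intro mult_right_mono flux_mult_le) auto
      also have "\<dots> = dbl * (flux_primitive (h z) \<bar>f z\<bar> * w z + flux_primitive (h z) \<bar>k z\<bar> * w z)"
        by (simp add: algebra_simps)
      finally have "ennreal (norm (f z * h z \<bar>f z\<bar> * k z * w z)) \<le>
          ennreal (dbl * (flux_primitive (h z) \<bar>f z\<bar> * w z + flux_primitive (h z) \<bar>k z\<bar> * w z))"
        by (rule ennreal_leI)
      then show ?case
        using H_nonneg w_nonneg[of z] by (simp add: ennreal_mult)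
    qed
  qed
  also have "\<dots> = ennreal dbl * (Mod f + Mod k)"
    unfolding Mod_def by (simp add: nn_integral_cmult nn_integral_add)
  also have "\<dots> < \<infinity>" using fin by (simp add: ennreal_mult_less_top)
  finally show "(\<integral>\<^sup>+ z. ennreal (norm (f z * h z \<bar>f z\<bar> * k z * w z)) \<partial>lebesgue) < \<infinity>" .
qed

end

subsection \<open>Comparison principle\<close>

text \<open>Negative arguments are reflected by oddness; for arguments of different sign the signs
  of the fluxes decide.\<close>

lemma (in growth_kernel) odd_flux_strict_mono:
  assumes "a < b"
  shows "a * k \<bar>a\<bar> < b * k \<bar>b\<bar>"
proof -
  consider "0 \<le> a" | "a < 0" "0 \<le> b" | "b < 0" using assms by linarith
  then show ?thesis
  proof cases
    case 1
    then show ?thesis using flux_strict_mono[of a b] assms by simp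
  next
    case 2
    have "a * k \<bar>a\<bar> < 0" using pos[of "\<bar>a\<bar>"] 2 by (simp add: mult_neg_pos)
    also have "0 \<le> b * k \<bar>b\<bar>" using flux_nonneg[of b] 2 by simp
    finally show ?thesis .
  next
    case 3
    then show ?thesis using flux_strict_mono[of "-b" "-a"] assms by simp
  qed
qed

text \<open>Every slice of the diagonal is a single point.\<close>

lemma AE_off_diagonal: "AE z in (lebesgue :: ('a::euclidean_space \<times> 'a) measure). fst z \<noteq> snd z"
proof -
  have "AE z in (lborel \<Otimes>\<^sub>M lborel :: ('a \<times> 'a) measure). fst z \<noteq> snd z"
  proof (rule lborel_pair.AE_pair_measure)
    have "closed {z :: 'a \<times> 'a. fst z = snd z}" by (intro closed_Collect_eq continuous_intros)
    then have "{z :: 'a \<times> 'a. fst z \<noteq> snd z} \<in> sets lborel"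
      by (simp add: borel_open open_Collect_neq continuous_intros)
    then show "{z \<in> space (lborel \<Otimes>\<^sub>M lborel). fst z \<noteq> snd z} \<in> sets (lborel \<Otimes>\<^sub>M lborel :: ('a \<times> 'a) measure)"
      unfolding lborel_prod by simp
    have "AE y in lborel. x \<noteq> y" for x :: 'a
      using AE_lborel_singleton[of x] by eventually_elim auto
    then show "AE x in lborel. AE y in lborel. fst (x :: 'a, y) \<noteq> snd (x, y)" by simp
  qed
  then show ?thesis unfolding AE_completion_iff lborel_prod .
qed

text \<open>The complement of a large closed ball is open and nonempty, hence not null.\<close>

lemma exists_outside_bounded:
  fixes \<Omega> :: "'a::euclidean_space set"
  assumes "bounded \<Omega>" "AE y in lebesgue. P y"
  shows "\<exists>y. y \<notin> \<Omega> \<and> P y"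
proof (rule ccontr)
  assume *: "\<not> ?thesis"
  obtain r where "\<Omega> \<subseteq> ball 0 r" using bounded_subset_ballD[OF assms(1), of 0] by blast
  then have r: "\<Omega> \<subseteq> cball 0 r" using ball_subset_cball by (rule order_trans)
  obtain N where "negligible N" "{y. \<not> P y} \<subseteq> N"
    using assms(2) unfolding eventually_ae_filter_negligible by blast
  then have "negligible (- cball (0 :: 'a) r)"
    using * r by (elim negligible_subset) auto
  moreover have "- cball (0 :: 'a) r \<noteq> {}"
  proof
    assume "- cball (0 :: 'a) r = {}"
    then have "cball (0 :: 'a) r = UNIV" by blast
    with bounded_cball[of "0 :: 'a" r] show False by (simp only: not_bounded_UNIV)
  qed
  ultimately show False using open_not_negligible[of "- cball (0 :: 'a) r"] by (simp add: open_Compl)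
qed

section \<open>The two modulars of the fractional space\<close>

locale fractional_kernel =
  fixes s gl gu :: real and g :: "'a::euclidean_space \<Rightarrow> 'a \<Rightarrow> real \<Rightarrow> real"
  assumes adm: "admissible_kernel gl gu g"
begin

lemma continuous_on_g: "continuous_on {0<..} (g x y)"
  using adm unfolding admissible_kernel_def by (intro locally_lipschitz_continuous_on) blast

text \<open>With \<open>g\<close> extended by 0 to \<open>r \<le> 0\<close>, slicing gives almost
  every \<open>r\<close> and continuity the others. The diagonal is null in the product, so its own
  measurability assumption is used.\<close>

lemma diag_measurable:
  assumes "0 < r"
  shows "(\<lambda>x. g x x r) \<in> borel_measurable lebesgue"
proof (rule measurable_slices_if_continuous[where h="\<lambda>x. g x x", OF _ continuous_on_g assms])
  let ?D = "UNIV \<times> {0<..} :: ('a \<times> real) set"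
  have "open ?D" by (intro open_Times) auto
  then have "?D \<in> sets lebesgue" by simp
  with adm have "(\<lambda>p. if p \<in> ?D then (\<lambda>(x, r). g x x r) p else 0) \<in> borel_measurable lebesgue"
    unfolding admissible_kernel_def by (intro borel_measurable_if_I) auto
  from AE_measurable_slices[OF this, of "\<lambda>(r, x). (x, r)" "\<lambda>(x, r). (r, x)"]
  have "AE r in lebesgue. (\<lambda>x. if 0 < r then g x x r else 0) \<in> borel_measurable lebesgue"
    by (auto simp: linear_iff)
  then show "AE r in lebesgue. 0 < r \<longrightarrow> (\<lambda>x. g x x r) \<in> borel_measurable lebesgue"
    by eventually_elim auto
qed

lemma off_diag_measurable:
  assumes "0 < r"
  shows "(\<lambda>z. g (fst z) (snd z) r) \<in> borel_measurable lebesgue"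
proof (rule measurable_slices_if_continuous[where h="\<lambda>z. g (fst z) (snd z)", OF _ continuous_on_g assms])
  let ?D = "UNIV \<times> UNIV \<times> {0<..} :: ('a \<times> 'a \<times> real) set"
  have "open ?D" by (intro open_Times) auto
  then have "?D \<in> sets lebesgue" by simp
  with adm have "(\<lambda>p. if p \<in> ?D then (\<lambda>(x, y, r). g x y r) p else 0) \<in> borel_measurable lebesgue"
    unfolding admissible_kernel_def by (intro borel_measurable_if_I) auto
  from AE_measurable_slices[OF this, of "\<lambda>p. (fst (snd p), snd (snd p), fst p)" "\<lambda>p. (snd (snd p), fst p, fst (snd p))"]
  have "AE r in lebesgue. (\<lambda>z. if 0 < r then g (fst z) (snd z) r else 0) \<in> borel_measurable lebesgue"
    by (simp add: linear_iff case_prod_unfold cong: if_cong)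
  then show "AE r in lebesgue. 0 < r \<longrightarrow> (\<lambda>z. g (fst z) (snd z) r) \<in> borel_measurable lebesgue"
    by eventually_elim auto
qed

abbreviation weight :: "'a \<times> 'a \<Rightarrow> real" where
  "weight z \<equiv> 1 / norm (fst z - snd z) ^ DIM('a)"

sublocale D: musielak_kernel gl gu "\<lambda>x. g x x" "\<lambda>x. 1"
proof
  show "AE x in lebesgue. growth_conditions gl gu (g x x)"
    using adm unfolding admissible_kernel_def by blast
qed (use adm diag_measurable in \<open>auto simp: admissible_kernel_def\<close>)

sublocale K: musielak_kernel gl gu "\<lambda>z. g (fst z) (snd z)" weight
proof
  show "AE z in lebesgue. growth_conditions gl gu (g (fst z) (snd z))"
    using adm unfolding admissible_kernel_def case_prod_beta by blast
  have "(\<lambda>z :: 'a \<times> 'a. norm (fst z - snd z)) \<in> borel_measurable lebesgue"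
    by (intro measurable_completion) (simp add: borel_measurable_continuous_onI continuous_intros)
  then show "weight \<in> borel_measurable lebesgue" by measurable
  show "AE z in lebesgue. 0 < weight z"
    using AE_off_diagonal by eventually_elim simp
qed (use adm off_diag_measurable in \<open>auto simp: admissible_kernel_def\<close>)

abbreviation \<delta> :: "('a \<Rightarrow> real) \<Rightarrow> 'a \<times> 'a \<Rightarrow> real" where
  "\<delta> u z \<equiv> frac_diff s u (fst z) (snd z)"

lemma modular_G_eq: "modular_G g u = D.Mod u"
  unfolding modular_G_def D.Mod_def bigG_def flux_primitive_def by simp

lemma modular_sG_eq: "modular_sG s g u = K.Mod (\<delta> u)"
  unfolding modular_sG_def K.Mod_def bigG_def flux_primitive_def by (simp add: case_prod_unfold)

lemma norm_sG_eq: "norm_sG s g u = D.lux u + K.lux (\<delta> u)"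
proof -
  have "\<delta> (\<lambda>x. u x / l) = (\<lambda>z. \<delta> u z / l)" for l
    by (auto simp: frac_diff_def diff_divide_distrib mult_ac)
  then show ?thesis
    unfolding norm_sG_def norm_G_def seminorm_sG_def D.lux_def K.lux_def modular_G_eq modular_sG_eq
    by simp
qed

lemma W_sG_iff:
  "u \<in> W_sG s g \<longleftrightarrow> u \<in> borel_measurable lebesgue \<and> D.Mod u < \<infinity> \<and> K.Mod (\<delta> u) < \<infinity>"
  unfolding W_sG_def L_G_def modular_G_eq modular_sG_eq by blast

lemma \<delta>_diff: "\<delta> (\<lambda>x. u x - v x) = (\<lambda>z. \<delta> u z - \<delta> v z)"
  by (auto simp: frac_diff_def diff_divide_distrib)

lemma W_sG_diff:
  assumes "u \<in> W_sG s g" "v \<in> W_sG s g"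
  shows "(\<lambda>x. u x - v x) \<in> W_sG s g"
proof -
  have uv: "u \<in> borel_measurable lebesgue" "v \<in> borel_measurable lebesgue"
    "D.Mod u < \<infinity>" "D.Mod v < \<infinity>" "K.Mod (\<delta> u) < \<infinity>" "K.Mod (\<delta> v) < \<infinity>"
    using assms unfolding W_sG_iff by blast+
  have "K.Mod (\<delta> (\<lambda>x. u x - v x)) < \<infinity>"
    unfolding \<delta>_diff using uv by (intro K.Mod_diff_finite borel_measurable_frac_diff)
  with D.Mod_diff_finite[OF uv(1-4)] borel_measurable_diff[OF uv(1,2)] show ?thesis
    unfolding W_sG_iff by blast
qed

section \<open>Stability of the space of vanishing exterior values under positive parts\<close>

lemma \<delta>_mono:
  assumes "\<And>x y. \<bar>v x - v y\<bar> \<le> \<bar>u x - u y\<bar>"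
  shows "\<bar>\<delta> v z\<bar> \<le> \<bar>\<delta> u z\<bar>"
  unfolding frac_diff_def abs_divide by (rule divide_right_mono[OF assms]) simp

text \<open>Both modulars are monotone in absolute value, so exact and smoothed positive parts stay
  in the space.\<close>

lemma W_sG_contraction:
  assumes u: "u \<in> W_sG s g" and v: "v \<in> borel_measurable lebesgue"
    and c: "\<And>x. \<bar>v x\<bar> \<le> \<bar>u x\<bar>" "\<And>x y. \<bar>v x - v y\<bar> \<le> \<bar>u x - u y\<bar>"
  shows "v \<in> W_sG s g"
proof -
  have "D.Mod v \<le> D.Mod u" "K.Mod (\<delta> v) \<le> K.Mod (\<delta> u)"
    using c \<delta>_mono[OF c(2)] by (auto intro: D.Mod_mono K.Mod_mono)
  with u v show ?thesis unfolding W_sG_iff by (auto intro: le_less_trans)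
qed

text \<open>The geometric rate makes the modulars of the errors summable, as
  \<open>AE_tendsto_0_if_summable_Mod\<close> and the dominated convergence require.\<close>

lemma W0_sG_approx:
  assumes "u \<in> W0_sG s g \<Omega>"
  obtains \<phi> where "\<And>n. \<phi> n \<in> test_functions \<Omega>" "\<And>n. \<phi> n \<in> W_sG s g"
    "\<And>n. D.Mod (\<lambda>x. u x - \<phi> n x) \<le> ennreal ((1 / 2) ^ n)"
    "\<And>n. K.Mod (\<delta> (\<lambda>x. u x - \<phi> n x)) \<le> ennreal ((1 / 2) ^ n)"
proof -
  have "\<exists>\<phi>. \<phi> \<in> test_functions \<Omega> \<and> \<phi> \<in> W_sG s g \<and> D.Mod (\<lambda>x. u x - \<phi> x) \<le> ennreal ((1 / 2) ^ n) \<and>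
    K.Mod (\<delta> (\<lambda>x. u x - \<phi> x)) \<le> ennreal ((1 / 2) ^ n)" for n
  proof -
    have n: "0 < (1 / 2 :: real) ^ n" "(1 / 2 :: real) ^ n \<le> 1" by (auto simp: power_le_one)
    have u: "u \<in> W_sG s g" using assms by (simp add: W0_sG_def)
    obtain \<phi> where \<phi>: "\<phi> \<in> test_functions \<Omega>" "\<phi> \<in> W_sG s g"
      "norm_sG s g (\<lambda>x. u x - \<phi> x) < (1 / 2) ^ n"
      using assms n(1) unfolding W0_sG_def by blast
    have W: "(\<lambda>x. u x - \<phi> x) \<in> borel_measurable lebesgue" "D.Mod (\<lambda>x. u x - \<phi> x) < \<infinity>"
      "K.Mod (\<delta> (\<lambda>x. u x - \<phi> x)) < \<infinity>"
      using W_sG_diff[OF u \<phi>(2)] unfolding W_sG_iff by auto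
    note m = borel_measurable_frac_diff[OF W(1)]
    \<comment> \<open>Since neither summand of the norm is negative, smallness of the sum passes to
      each.\<close>
    have "0 \<le> D.lux (\<lambda>x. u x - \<phi> x)" "0 \<le> K.lux (\<delta> (\<lambda>x. u x - \<phi> x))"
      using D.lux_nonneg[OF W(1,2)] K.lux_nonneg[OF m W(3)] by auto
    then have "D.lux (\<lambda>x. u x - \<phi> x) < (1 / 2) ^ n" "K.lux (\<delta> (\<lambda>x. u x - \<phi> x)) < (1 / 2) ^ n"
      using \<phi>(3) unfolding norm_sG_eq by linarith+
    then show ?thesis
      using D.Mod_le_if_lux_less[OF W(1,2) _ n(2)] K.Mod_le_if_lux_less[OF m W(3) _ n(2)] \<phi> by blast
  qed
  then have "\<forall>n. \<exists>\<phi>. \<phi> \<in> test_functions \<Omega> \<and> \<phi> \<in> W_sG s g \<and> D.Mod (\<lambda>x. u x - \<phi> x) \<le> ennreal ((1 / 2) ^ n) \<and>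
    K.Mod (\<delta> (\<lambda>x. u x - \<phi> x)) \<le> ennreal ((1 / 2) ^ n)" ..
  from choice[OF this] obtain \<phi> where "\<forall>n. \<phi> n \<in> test_functions \<Omega> \<and> \<phi> n \<in> W_sG s g \<and>
    D.Mod (\<lambda>x. u x - \<phi> n x) \<le> ennreal ((1 / 2) ^ n) \<and> K.Mod (\<delta> (\<lambda>x. u x - \<phi> n x)) \<le> ennreal ((1 / 2) ^ n)" ..
  then show ?thesis by (intro that[of \<phi>]) blast+
qed

lemma suminf_geometric_finite:
  fixes a :: "nat \<Rightarrow> ennreal"
  assumes "0 \<le> c" "\<And>n. a n \<le> ennreal c * (ennreal ((1 / 2) ^ n) + ennreal ((1 / 2) ^ n))"
  shows "(\<Sum>n. a n) < \<infinity>"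
proof -
  have "(\<Sum>n. a n) \<le> (\<Sum>n. ennreal (2 * c * (1 / 2) ^ n))"
  proof (rule suminf_le[OF _ summableI summableI])
    fix n
    have "ennreal c * (ennreal ((1 / 2) ^ n) + ennreal ((1 / 2) ^ n)) = ennreal (2 * c * (1 / 2) ^ n)"
    proof -
      have "c * (p + p) = 2 * c * p" for p :: real by (simp add: algebra_simps)
      then show ?thesis
        using assms(1) by (simp only: ennreal_plus[symmetric] ennreal_mult[symmetric] zero_le_power zero_le_divide_1_iff zero_le_numeral add_nonneg_nonneg)
    qed
    with assms(2)[of n] show "a n \<le> ennreal (2 * c * (1 / 2) ^ n)" by simp
  qed
  also have "\<dots> = ennreal (\<Sum>n. 2 * c * (1 / 2) ^ n)"
    using assms(1) by (intro suminf_ennreal2 summable_mult summable_geometric) auto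
  finally show ?thesis by (rule le_less_trans) simp
qed

lemma W0_sG_pos_part:
  assumes u: "u \<in> W0_sG s g \<Omega>" and u': "u' \<in> W0_sG s g \<Omega>"
  shows "(\<lambda>x. max (u' x - u x) 0) \<in> W0_sG s g \<Omega>"
proof -
  define v where "v x = max (u' x - u x) 0" for x
  define d where "d x = u' x - u x" for x
  have W: "u \<in> W_sG s g" "u' \<in> W_sG s g" using u u' by (auto simp: W0_sG_def)
  have dW: "d \<in> W_sG s g" unfolding d_def using W by (intro W_sG_diff)
  have max_diff: "\<bar>max a 0 - max b 0\<bar> \<le> \<bar>a - b\<bar>" for a b :: real
    by (auto simp: max_def abs_if)
  have v_d: "\<bar>v x\<bar> \<le> \<bar>d x\<bar>" "\<bar>v x - v y\<bar> \<le> \<bar>d x - d y\<bar>" for x y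
    using max_diff unfolding v_def d_def by (auto simp: max_def)
  have [measurable]: "d \<in> borel_measurable lebesgue" using dW by (simp add: W_sG_iff)
  have vm[measurable]: "v \<in> borel_measurable lebesgue" unfolding v_def d_def[symmetric] by measurable
  have vW: "v \<in> W_sG s g" by (rule W_sG_contraction[OF dW vm v_d])
  obtain \<phi> where \<phi>: "\<And>n. \<phi> n \<in> test_functions \<Omega>" "\<And>n. \<phi> n \<in> W_sG s g"
    "\<And>n. D.Mod (\<lambda>x. u' x - \<phi> n x) \<le> ennreal ((1 / 2) ^ n)"
    "\<And>n. K.Mod (\<delta> (\<lambda>x. u' x - \<phi> n x)) \<le> ennreal ((1 / 2) ^ n)"
    using W0_sG_approx[OF u'] by blast
  obtain \<psi> where \<psi>: "\<And>n. \<psi> n \<in> test_functions \<Omega>" "\<And>n. \<psi> n \<in> W_sG s g"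
    "\<And>n. D.Mod (\<lambda>x. u x - \<psi> n x) \<le> ennreal ((1 / 2) ^ n)"
    "\<And>n. K.Mod (\<delta> (\<lambda>x. u x - \<psi> n x)) \<le> ennreal ((1 / 2) ^ n)"
    using W0_sG_approx[OF u] by blast
  define diff where "diff n x = \<phi> n x - \<psi> n x" for n x
  define e where "e n x = diff n x - d x" for n x
  define \<epsilon> where "\<epsilon> n = (1 / 2 :: real) ^ n" for n
  have \<epsilon>: "0 < \<epsilon> n" for n by (simp add: \<epsilon>_def)
  define sm where "sm n x = smooth_pos (\<epsilon> n) (diff n x)" for n x
  define f where "f n x = v x - sm n x" for n x
  have diff_W: "diff n \<in> W_sG s g" for n unfolding diff_def using \<phi>(2) \<psi>(2) by (intro W_sG_diff)
  have [measurable]: "diff n \<in> borel_measurable lebesgue" for n using diff_W by (simp add: W_sG_iff)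
  have sm_meas[measurable]: "sm n \<in> borel_measurable lebesgue" for n
    unfolding sm_def smooth_pos_def by measurable
  have em[measurable]: "e n \<in> borel_measurable lebesgue" for n unfolding e_def by measurable
  have fm[measurable]: "f n \<in> borel_measurable lebesgue" for n unfolding f_def by measurable
  have smooth_le: "\<bar>sm n x\<bar> \<le> \<bar>diff n x\<bar>" "\<bar>sm n x - sm n y\<bar> \<le> \<bar>diff n x - diff n y\<bar>" for n x y
    using smooth_pos_lipschitz[of "\<epsilon> n" "diff n x" 0] smooth_pos_lipschitz[of "\<epsilon> n" "diff n x" "diff n y"]
    by (auto simp: sm_def smooth_pos_0[OF \<epsilon>])
  have sm_W: "sm n \<in> W_sG s g" for n by (rule W_sG_contraction[OF diff_W sm_meas smooth_le])
  have sm_test: "sm n \<in> test_functions \<Omega>" for n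
    unfolding sm_def diff_def using \<epsilon> \<phi>(1) \<psi>(1) by (rule smooth_pos_diff_test_functions)
  have sumD: "(\<Sum>n. D.Mod (e n)) < \<infinity>"
  proof (rule suminf_geometric_finite[of D.dbl])
    fix n
    have "D.Mod (e n) \<le> ennreal D.dbl * (D.Mod (\<lambda>x. u' x - \<phi> n x) + D.Mod (\<lambda>x. u x - \<psi> n x))"
      using W_sG_diff[OF W(2) \<phi>(2)] W_sG_diff[OF W(1) \<psi>(2)]
      by (intro D.Mod_add_le) (auto simp: W_sG_iff e_def diff_def d_def)
    also have "\<dots> \<le> ennreal D.dbl * (ennreal ((1 / 2) ^ n) + ennreal ((1 / 2) ^ n))"
      by (intro mult_left_mono add_mono \<phi>(3) \<psi>(3)) simp
    finally show "D.Mod (e n) \<le> \<dots>" .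
  qed simp
  have sumK: "(\<Sum>n. K.Mod (\<delta> (e n))) < \<infinity>"
  proof (rule suminf_geometric_finite[of D.dbl])
    fix n
    \<comment> \<open>The errors regroup as \<open>e n = (u - \<psi> n) - (u' - \<phi> n)\<close>,
      two pieces whose modulars are controlled.\<close>
    have "\<delta> (e n) z = \<delta> (\<lambda>x. u x - \<psi> n x) z - \<delta> (\<lambda>x. u' x - \<phi> n x) z" for z
      by (simp add: frac_diff_def e_def diff_def d_def diff_divide_distrib[symmetric])
    then have "K.Mod (\<delta> (e n)) \<le> ennreal D.dbl * (K.Mod (\<delta> (\<lambda>x. u' x - \<phi> n x)) + K.Mod (\<delta> (\<lambda>x. u x - \<psi> n x)))"
      using W_sG_diff[OF W(2) \<phi>(2)] W_sG_diff[OF W(1) \<psi>(2)]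
      by (intro K.Mod_add_le borel_measurable_frac_diff) (auto simp: W_sG_iff)
    also have "\<dots> \<le> ennreal D.dbl * (ennreal ((1 / 2) ^ n) + ennreal ((1 / 2) ^ n))"
      by (intro mult_left_mono add_mono \<phi>(4) \<psi>(4)) simp
    finally show "K.Mod (\<delta> (e n)) \<le> \<dots>" .
  qed simp
  have limD: "AE x in lebesgue. (\<lambda>n. f n x) \<longlonglongrightarrow> 0"
    using D.AE_tendsto_0_if_summable_Mod[OF em sumD]
  proof eventually_elim
    case (elim x)
    have "\<epsilon> \<longlonglongrightarrow> 0" unfolding \<epsilon>_def by (intro LIMSEQ_power_zero) simp
    then have "(\<lambda>n. \<epsilon> n + \<bar>e n x\<bar>) \<longlonglongrightarrow> 0 + 0"
      using elim by (intro tendsto_add tendsto_rabs_zero)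
    \<comment> \<open>One \<open>\<epsilon> n\<close> pays for the smoothing; the rest is the
      contraction \<open>max_diff\<close> applied to \<open>diff n\<close> and
      \<open>d\<close>.\<close>
    moreover have "\<bar>f n x\<bar> \<le> \<epsilon> n + \<bar>e n x\<bar>" for n
      using smooth_pos_approx[OF \<epsilon>, of n "diff n x"] max_diff[of "diff n x" "d x"]
      unfolding f_def sm_def v_def e_def d_def[symmetric] by linarith
    ultimately have "(\<lambda>n. \<bar>f n x\<bar>) \<longlonglongrightarrow> 0"
      by (intro tendsto_sandwich[of "\<lambda>_. 0" "\<lambda>n. \<bar>f n x\<bar>" _ "\<lambda>n. \<epsilon> n + \<bar>e n x\<bar>"]) simp_all
    then show ?case by (rule tendsto_rabs_zero_cancel)
  qed
  have limK: "AE z in lebesgue. (\<lambda>n. \<delta> (f n) z) \<longlonglongrightarrow> 0"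
    \<comment> \<open>For almost every pair, \<open>f n\<close> tends to 0 at both points, hence so
      does the quotient.\<close>
    using AE_lebesgue_fst[OF limD, where 'b='a] AE_lebesgue_snd[OF limD, where 'b='a]
  proof eventually_elim
    case (elim z)
    from tendsto_divide_zero[OF tendsto_diff[OF elim, simplified]]
    show ?case unfolding frac_diff_def .
  qed
  have d_fin: "D.Mod d < \<infinity>" "K.Mod (\<delta> d) < \<infinity>" and dm: "d \<in> borel_measurable lebesgue"
    using dW by (auto simp: W_sG_iff)
  \<comment> \<open>The fixed majorant is \<open>2 * d\<close>: both \<open>v\<close> and
    \<open>sm n\<close> are contractions, of \<open>d\<close> and of
    \<open>diff n = d + e n\<close>, so their difference is bounded by twice \<open>d\<close> plus
    \<open>e n\<close> in absolute value.\<close>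
  have "D.Mod (\<lambda>x. 2 * d x) \<le> ennreal D.dbl * D.Mod d"
    using dm by (intro D.Mod_scale_upper) simp
  also have "\<dots> < \<infinity>" using d_fin by (simp add: ennreal_mult_less_top)
  finally have D2: "D.Mod (\<lambda>x. 2 * d x) < \<infinity>" .
  have "K.Mod (\<lambda>z. 2 * \<delta> d z) \<le> ennreal D.dbl * K.Mod (\<delta> d)"
    using borel_measurable_frac_diff[OF dm] by (intro K.Mod_scale_upper) simp
  also have "\<dots> < \<infinity>" using d_fin by (simp add: ennreal_mult_less_top)
  finally have K2: "K.Mod (\<lambda>z. 2 * \<delta> d z) < \<infinity>" .
  have D0: "(\<lambda>n. D.Mod (f n)) \<longlonglongrightarrow> 0"
  proof (rule D.Mod_tendsto_0_dominated[OF fm em _ _ sumD D2 limD])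
    show "(\<lambda>x. 2 * d x) \<in> borel_measurable lebesgue" by measurable
    show "AE x in lebesgue. \<bar>f n x\<bar> \<le> \<bar>e n x\<bar> + \<bar>2 * d x\<bar>" for n
    proof (rule AE_I2)
      fix x
      show "\<bar>f n x\<bar> \<le> \<bar>e n x\<bar> + \<bar>2 * d x\<bar>"
        using smooth_le(1)[of n x] v_d(1)[of x] unfolding f_def e_def by linarith
    qed
  qed
  have K0: "(\<lambda>n. K.Mod (\<delta> (f n))) \<longlonglongrightarrow> 0"
  proof (rule K.Mod_tendsto_0_dominated[OF borel_measurable_frac_diff[OF fm]
        borel_measurable_frac_diff[OF em] _ _ sumK K2 limK])
    show "(\<lambda>z. 2 * \<delta> d z) \<in> borel_measurable lebesgue"
      using borel_measurable_frac_diff[OF dm] by (rule borel_measurable_times[OF borel_measurable_const])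
    show "AE z in lebesgue. \<bar>\<delta> (f n) z\<bar> \<le> \<bar>\<delta> (e n) z\<bar> + \<bar>2 * \<delta> d z\<bar>" for n
    proof (rule AE_I2)
      fix z
      have "\<delta> (f n) z = \<delta> v z - \<delta> (sm n) z" "\<delta> (e n) z = \<delta> (diff n) z - \<delta> d z"
        by (simp_all add: f_def e_def frac_diff_def diff_divide_distrib[symmetric])
      then show "\<bar>\<delta> (f n) z\<bar> \<le> \<bar>\<delta> (e n) z\<bar> + \<bar>2 * \<delta> d z\<bar>"
        using \<delta>_mono[of "sm n" "diff n" z, OF smooth_le(2)] \<delta>_mono[of v d z, OF v_d(2)] by linarith
    qed
  qed
  have "\<exists>\<phi> \<in> test_functions \<Omega> \<inter> W_sG s g. norm_sG s g (\<lambda>x. v x - \<phi> x) < \<eta>" if "0 < \<eta>" for \<eta>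
  proof -
    \<comment> \<open>Each of the two Luxemburg norms gets a third of \<open>\<eta>\<close>, so the
      sum stays strictly below \<open>\<eta>\<close>; the cap 1 meets the hypothesis
      \<open>e \<le> 1\<close> of \<open>lux_le_if_Mod_le\<close>.\<close>
    define q where "q = min \<eta> 1 / 3"
    have q: "0 < q" "q \<le> 1" "q + q < \<eta>" using that by (auto simp: q_def)
    have "0 < ennreal (q powr (gu + 1))" using q by simp
    then have "eventually (\<lambda>n. D.Mod (f n) < ennreal (q powr (gu + 1)) \<and> K.Mod (\<delta> (f n)) < ennreal (q powr (gu + 1))) sequentially"
      by (intro eventually_conj order_tendstoD(2)[OF D0] order_tendstoD(2)[OF K0])
    then obtain n where "D.Mod (f n) < ennreal (q powr (gu + 1))" "K.Mod (\<delta> (f n)) < ennreal (q powr (gu + 1))"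
      unfolding eventually_sequentially by blast
    then have "D.lux (f n) \<le> q" "K.lux (\<delta> (f n)) \<le> q"
      using q fm[of n] borel_measurable_frac_diff[OF fm[of n]]
      by (simp_all add: D.lux_le_if_Mod_le K.lux_le_if_Mod_le less_imp_le)
    then have "norm_sG s g (f n) < \<eta>" using q unfolding norm_sG_eq by linarith
    with sm_test[of n] sm_W[of n] show ?thesis unfolding f_def by blast
  qed
  moreover have "AE x in lebesgue. x \<notin> \<Omega> \<longrightarrow> v x = 0"
  proof -
    have "AE x in lebesgue. x \<notin> \<Omega> \<longrightarrow> u x = 0" "AE x in lebesgue. x \<notin> \<Omega> \<longrightarrow> u' x = 0"
      using u u' by (auto simp: W0_sG_def)
    then show ?thesis by eventually_elim (simp add: v_def)
  qed
  ultimately have "v \<in> W0_sG s g \<Omega>" using vW by (simp add: W0_sG_def)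
  then show ?thesis by (simp add: v_def[abs_def])
qed

section \<open>The weak form and the comparison argument\<close>

lemma frac_g_laplacian_eq:
  "frac_g_laplacian s g u v =
    (\<integral> z. \<delta> u z * g (fst z) (snd z) \<bar>\<delta> u z\<bar> * \<delta> v z * weight z \<partial>lebesgue)"
  unfolding frac_g_laplacian_def case_prod_unfold
  by (rule Bochner_Integration.integral_cong) (simp_all add: mult.commute[of "\<delta> u _"])

lemma comparison:
  assumes \<Omega>: "bounded \<Omega>"
    and u: "u \<in> W0_sG s g \<Omega>" and u': "u' \<in> W0_sG s g \<Omega>"
    and le: "frac_g_laplacian s g u' (\<lambda>x. max (u' x - u x) 0) \<le> frac_g_laplacian s g u (\<lambda>x. max (u' x - u x) 0)"
  shows "AE x in lebesgue. u' x \<le> u x"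
proof -
  define v where "v x = max (u' x - u x) 0" for x
  have v0: "v \<in> W0_sG s g \<Omega>" using W0_sG_pos_part[OF u u'] by (simp add: v_def[abs_def])
  have W: "u \<in> W_sG s g" "u' \<in> W_sG s g" "v \<in> W_sG s g" using u u' v0 by (auto simp: W0_sG_def)
  define I where "I u z = \<delta> u z * g (fst z) (snd z) \<bar>\<delta> u z\<bar> * \<delta> v z * weight z" for u z
  have int: "integrable lebesgue (I u)" "integrable lebesgue (I u')"
    unfolding I_def using W unfolding W_sG_iff
    by (intro K.integrable_flux_mult borel_measurable_frac_diff; simp)+
  have sgn: "AE z in lebesgue. 0 \<le> I u' z - I u z \<and> (I u' z - I u z = 0 \<longrightarrow> v (fst z) = v (snd z))"
    using K.growth_kernel K.w_pos AE_off_diagonal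
  proof eventually_elim
    case (elim z)
    interpret growth_kernel gl gu "g (fst z) (snd z)" by fact
    let ?A = "\<lambda>t. t * g (fst z) (snd z) \<bar>t\<bar>"
    define N where "N = norm (fst z - snd z) powr s"
    have N: "0 < N" using elim(3) by (simp add: N_def)
    have eq: "I u' z - I u z = (?A (\<delta> u' z) - ?A (\<delta> u z)) * \<delta> v z * weight z"
      by (simp add: I_def algebra_simps)
    have dv: "\<delta> v z = (v (fst z) - v (snd z)) / N" for v by (simp add: frac_diff_def N_def)
    have dv_0: "v (fst z) = v (snd z)" if "\<delta> v z = 0" using that N by (simp add: dv)
    \<comment> \<open>\<open>X\<close> will be the difference of fluxes and \<open>c\<close> the
      difference quotient of \<open>v\<close>. A nonzero \<open>X\<close> forces
      \<open>c = 0\<close> when the product vanishes.\<close>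
    have sgn_mult: "0 \<le> X * c * W \<and> (X * c * W = 0 \<longrightarrow> c = 0)"
      if "0 < X \<and> 0 \<le> c \<or> X < 0 \<and> c \<le> 0" "0 < W" for X c W :: real
      using that by (auto simp: zero_le_mult_iff)
    consider "\<delta> u z < \<delta> u' z" | "\<delta> u' z < \<delta> u z" | "\<delta> u z = \<delta> u' z" by linarith
    then show ?case
    proof cases
      case 1
      then have "u (fst z) - u (snd z) < u' (fst z) - u' (snd z)"
        using N by (simp add: dv divide_less_cancel)
      then have "v (snd z) \<le> v (fst z)" by (simp add: v_def)
      then have "0 \<le> \<delta> v z" using N by (simp add: dv)
      moreover have "0 < ?A (\<delta> u' z) - ?A (\<delta> u z)" using odd_flux_strict_mono[OF 1] by simp
      ultimately show ?thesis using sgn_mult[OF _ elim(2)] dv_0 unfolding eq by blast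
    next
      case 2
      then have "u' (fst z) - u' (snd z) < u (fst z) - u (snd z)"
        using N by (simp add: dv divide_less_cancel)
      then have "v (fst z) \<le> v (snd z)" by (simp add: v_def)
      then have "\<delta> v z \<le> 0" using N by (simp add: dv divide_le_0_iff)
      moreover have "?A (\<delta> u' z) - ?A (\<delta> u z) < 0" using odd_flux_strict_mono[OF 2] by simp
      ultimately show ?thesis using sgn_mult[OF _ elim(2)] dv_0 unfolding eq by blast
    next
      \<comment> \<open>Here the flux difference is 0 and gives no information, but
        \<open>u' - u\<close> has equal values at both points, hence so has
        \<open>v\<close>.\<close>
      case 3
      then have "u (fst z) - u (snd z) = u' (fst z) - u' (snd z)" using N by (simp add: dv)
      then have "v (fst z) = v (snd z)" by (simp add: v_def)
      then show ?thesis by (simp add: eq dv)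
    qed
  qed
  have int': "integrable lebesgue (\<lambda>z. I u' z - I u z)" using int by simp
  have "(\<integral> z. I u' z - I u z \<partial>lebesgue) \<le> 0"
    using int le unfolding frac_g_laplacian_eq I_def v_def[symmetric] by simp
  moreover have nn: "AE z in lebesgue. 0 \<le> I u' z - I u z" using sgn by eventually_elim simp
  then have "0 \<le> (\<integral> z. I u' z - I u z \<partial>lebesgue)" by (rule integral_nonneg_AE)
  ultimately have "AE z in lebesgue. I u' z - I u z = 0"
    using integral_nonneg_eq_0_iff_AE[OF int' nn] by simp
  then have "AE z in lebesgue. v (fst z) = v (snd z)" using sgn by eventually_elim simp
  from AE_lebesgue_pair[OF this] show ?thesis
  proof eventually_elim
    case (elim x)
    \<comment> \<open>For almost every \<open>x\<close>, the value \<open>v x\<close> is shared by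
      almost every \<open>y\<close>; one such \<open>y\<close> outside \<open>\<Omega>\<close> with
      \<open>v y = 0\<close> settles it.\<close>
    have "AE y in lebesgue. y \<notin> \<Omega> \<longrightarrow> v y = 0" using v0 by (simp add: W0_sG_def)
    with elim have "AE y in lebesgue. v x = v y \<and> (y \<notin> \<Omega> \<longrightarrow> v y = 0)" by simp
    from exists_outside_bounded[OF \<Omega> this] have "v x = 0" by auto
    then show ?case by (simp add: v_def max_def split: if_splits)
  qed
qed

end

theorem proposition3p5:
  fixes s gl gu :: real
    and \<Omega> :: "'a::euclidean_space set"
    and g :: "'a \<Rightarrow> 'a \<Rightarrow> real \<Rightarrow> real"
    and F F' :: "('a \<Rightarrow> real) \<Rightarrow> real"
    and u u' :: "'a \<Rightarrow> real"
  assumes "0 < s" and "s < 1"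
    and "bounded_lipschitz_domain \<Omega>"
    and "admissible_kernel gl gu g"
    and "F \<in> dual_W0 s g \<Omega>" and "F' \<in> dual_W0 s g \<Omega>"
    and "dirichlet_solution s g \<Omega> F u"
    and "dirichlet_solution s g \<Omega> F' u'"
    and "dual_ge s g \<Omega> F F'"
  shows "AE x in lebesgue. x \<in> \<Omega> \<longrightarrow> u' x \<le> u x"
proof -
  interpret fractional_kernel s gl gu g using assms(4) by unfold_locales
  let ?v = "\<lambda>x. max (u' x - u x) 0"
  have u: "u \<in> W0_sG s g \<Omega>" "u' \<in> W0_sG s g \<Omega>"
    using assms(7,8) by (auto simp: dirichlet_solution_def)
  then have v: "?v \<in> W0_sG s g \<Omega>" by (rule W0_sG_pos_part)
  \<comment> \<open>As \<open>?v\<close> is nonnegative, it may be used in the order of the dual;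
    the two equations turn this into an inequality between weak forms.\<close>
  then have "0 \<le> F ?v - F' ?v"
    using assms(9) unfolding dual_ge_def dual_nonneg_def by auto
  then have "frac_g_laplacian s g u' ?v \<le> frac_g_laplacian s g u ?v"
    using assms(7,8) v by (simp add: dirichlet_solution_def)
  moreover have "bounded \<Omega>" using assms(3) by (simp add: bounded_lipschitz_domain_def)
  ultimately have "AE x in lebesgue. u' x \<le> u x" using u by (intro comparison)
  then show ?thesis by eventually_elim simp
qed

end
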